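(* Let $\mathcal C$ be a class of square-lattice self-avoiding polygons. For $m,n\in\mathbb N_0$ let $p_{m,n}$ be the number of polygons in $\mathcal C$ of half-perimeter $m$ and area $n$, let $p_m=\sum_n p_{m,n}$, $p_m^{(k)}=\sum_n n^k p_{m,n}$, and $\mathcal P(x)=\sum_{m\ge0}p_m x^m$. Assume that for every $k\in\mathbb N_0$ $$p_m^{(k)}\sim A_k\,x_c^{-m}\,m^{\gamma_k-1}\qquad(m\to\infty)$$ for numbers $A_k>0$, $x_c>0$ and $\gamma_k=(k-\theta)/\phi$, where $\theta,\phi$ are real constants with $0<\phi<1$. Fix $r\ge1$ and $s\in\mathbb N$ such that $[x^s](\mathcal P(x))^r\neq0$. For $m,n$ let $p_{m,n}^{(r,s)}$ be the number of punctured polygons of the class with $r$ punctures, half-perimeter $m$ and area $n$, such that the sum of the half-perimeters of the $r$ puncturing polygons equals $s$, and let $p_m^{(r,k,s)}=\sum_n n^k p_{m,n}^{(r,s)}$. Then for every $k\in\mathbb N_0$ $$p_m^{(r,k,s)}\sim A_k^{(r,s)}\,x_c^{-m}\,m^{\gamma_{k+r}-1}\qquad(m\to\infty),\qquad A_k^{(r,s)}=\frac{A_{k+r}}{r!}\,x_c^{s}\,[x^s](\mathcal P(x))^r.$$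
   Context: Polygons are considered up to translation. The half-perimeter of a polygon is half its number of edges and its area is the number of unit cells it encloses. A punctured polygon of the class with $r$ punctures consists of an outer polygon from $\mathcal C$ and an unordered collection of $r$ polygons from $\mathcal C$ (the punctures/holes) lying inside the outer polygon, such that the boundary curves of all these $r+1$ polygons are pairwise disjoint. Its half-perimeter is the sum of the half-perimeters of the outer polygon and all holes; its area is the area of the outer polygon minus the areas of the holes. $[x^s]G(x)$ denotes the coefficient of $x^s$ in the power series $G$. *)

theory Defs
  imports "HOL-Analysis.Analysis" "HOL-Library.Landau_Symbols"
    "HOL-Computational_Algebra.Formal_Power_Series"
begin

text \<open>A polygon is represented by its set of edges, an edge being the two-element set of its
  end points, so that neither a starting point nor an orientation is distinguished.\<close>

type_synonym point = "int \<times> int"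
type_synonym polygon = "point set set"

definition adjacent :: "point \<Rightarrow> point \<Rightarrow> bool" where
  "adjacent u v \<longleftrightarrow> \<bar>fst u - fst v\<bar> + \<bar>snd u - snd v\<bar> = 1"

text \<open>The bound on the length only rules out a single edge traversed back and forth.\<close>

definition self_avoiding_polygon :: "polygon \<Rightarrow> bool" where
  "self_avoiding_polygon P \<longleftrightarrow>
     (\<exists>vs. length vs > 2 \<and> distinct vs \<and>
        (\<forall>i<length vs. adjacent (vs ! i) (vs ! (Suc i mod length vs))) \<and>
        P = {{vs ! i, vs ! (Suc i mod length vs)} | i. i < length vs})"

definition translate :: "point \<Rightarrow> polygon \<Rightarrow> polygon" where
  "translate t P = (\<lambda>e. (\<lambda>v. t + v) ` e) ` P"

text \<open>A class of polygons up to translation, given as the set of all representatives.\<close>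

definition polygon_class :: "polygon set \<Rightarrow> bool" where
  "polygon_class C \<longleftrightarrow>
     (\<forall>P\<in>C. self_avoiding_polygon P) \<and> (\<forall>P\<in>C. \<forall>t. translate t P \<in> C)"

definition plane_point :: "point \<Rightarrow> real \<times> real" where
  "plane_point v = (of_int (fst v), of_int (snd v))"

text \<open>The convex hull of the two end points of an edge is the closed segment between them.\<close>

definition boundary :: "polygon \<Rightarrow> (real \<times> real) set" where
  "boundary P = (\<Union>e\<in>P. convex hull (plane_point ` e))"

definition unit_cell :: "point \<Rightarrow> (real \<times> real) set" where
  "unit_cell c = {of_int (fst c)<..<of_int (fst c) + 1} \<times> {of_int (snd c)<..<of_int (snd c) + 1}"

definition area :: "polygon \<Rightarrow> nat" where
  "area P = card {c. unit_cell c \<subseteq> inside (boundary P)}"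

text \<open>The division is exact: a closed walk on the square lattice has even length.\<close>

definition half_perimeter :: "polygon \<Rightarrow> nat" where
  "half_perimeter P = card P div 2"

definition polygon_transl :: "polygon rel" where
  "polygon_transl = {(P, translate t P) | P t. True}"

definition poly_count :: "polygon set \<Rightarrow> nat \<Rightarrow> nat \<Rightarrow> nat" where
  "poly_count C m n = card ({P \<in> C. half_perimeter P = m \<and> area P = n} // polygon_transl)"

definition poly_total :: "polygon set \<Rightarrow> nat \<Rightarrow> real" where
  "poly_total C m = (\<Sum>n. real (poly_count C m n))"

definition poly_moment :: "polygon set \<Rightarrow> nat \<Rightarrow> nat \<Rightarrow> real" where
  "poly_moment C k m = (\<Sum>n. real n ^ k * real (poly_count C m n))"

definition poly_gf :: "polygon set \<Rightarrow> real fps" where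
  "poly_gf C = Abs_fps (poly_total C)"

text \<open>The first component is the outer polygon, the second one the collection of holes.  A set
  suffices for the latter, since polygons with disjoint boundaries are distinct.\<close>

type_synonym punctured = "polygon \<times> polygon set"

definition punctured_polygons :: "polygon set \<Rightarrow> nat \<Rightarrow> punctured set" where
  "punctured_polygons C r =
     {(P, H). P \<in> C \<and> H \<subseteq> C \<and> finite H \<and> card H = r \<and>
        (\<forall>Q\<in>H. boundary Q \<subseteq> inside (boundary P)) \<and>
        pairwise (\<lambda>Q R. disjnt (boundary Q) (boundary R)) (insert P H)}"

definition holes_half_perimeter :: "punctured \<Rightarrow> nat" where
  "holes_half_perimeter X = (\<Sum>Q\<in>snd X. half_perimeter Q)"

definition punctured_half_perimeter :: "punctured \<Rightarrow> nat" where
  "punctured_half_perimeter X = half_perimeter (fst X) + holes_half_perimeter X"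

text \<open>Integer-valued, to keep the subtraction from being truncated.\<close>

definition punctured_area :: "punctured \<Rightarrow> int" where
  "punctured_area X = int (area (fst X)) - (\<Sum>Q\<in>snd X. int (area Q))"

text \<open>Outer polygon and holes are translated simultaneously.\<close>

definition punctured_transl :: "punctured rel" where
  "punctured_transl = {((P, H), (translate t P, translate t ` H)) | P H t. True}"

definition punctured_count :: "polygon set \<Rightarrow> nat \<Rightarrow> nat \<Rightarrow> nat \<Rightarrow> nat \<Rightarrow> nat" where
  "punctured_count C r s m n =
     card ({X \<in> punctured_polygons C r. punctured_half_perimeter X = m \<and>
              punctured_area X = int n \<and> holes_half_perimeter X = s} // punctured_transl)"

definition punctured_moment :: "polygon set \<Rightarrow> nat \<Rightarrow> nat \<Rightarrow> nat \<Rightarrow> nat \<Rightarrow> real" where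
  "punctured_moment C r k s m = (\<Sum>n. real n ^ k * real (punctured_count C r s m n))"

end

theory Submission
  imports Defs
    "HOL-Combinatorics.Multiset_Permutations" "HOL-Real_Asymp.Real_Asymp"
begin

text \<open>Choose a representative of each translation class having the origin as a vertex, so that the
  translation vector of a hole is itself a vertex of the hole.  Identifying a unit cell with its lower
  left corner, a hole inside \<open>P\<close> is then placed at one of the \<open>n = area P\<close> cells of \<open>P\<close>; conversely,
  since the boundary of a hole is connected, a cell of \<open>P\<close> is an admissible position as soon as the
  two boundaries do not meet.  Only cells at bounded distance from one of the \<open>O(m)\<close> vertices of \<open>P\<close>
  can be bad, and two holes collide only if their positions are at bounded distance.  Hence \<open>r\<close> ordered
  holes of prescribed shapes can be placed in \<open>n ^ r + O(m n ^ (r - 1))\<close> ways, and the moments of the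
  punctured polygons differ from a multiple of the \<open>(k + r)\<close>-th moment of \<open>C\<close> by at most \<open>O(m)\<close> times
  the \<open>(k + r - 1)\<close>-th one.  The latter is smaller by a factor \<open>m powr (- 1 / \<phi>)\<close>, so that \<open>\<phi> < 1\<close>
  makes the error negligible.\<close>

section \<open>Geometry of lattice polygons\<close>

lemma translate_translate: "translate s (translate t P) = translate (s + t) P"
  by (simp add: translate_def image_image add.assoc)

lemma translate_zero [simp]: "translate 0 P = P"
  by (simp add: translate_def)

lemma translate_minus [simp]: "translate (- t) (translate t P) = P" "translate t (translate (- t) P) = P"
  by (simp_all add: translate_translate)

lemma inj_translate: "inj (translate t)"
  by (metis injI translate_minus(1))

lemma Union_translate: "\<Union> (translate t P) = (+) t ` \<Union> P"
  by (auto simp: translate_def)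

lemma card_translate: "card (translate t P) = card P"
proof -
  have "inj ((`) ((+) t))"
    by (simp add: inj_image_eq_iff inj_def)
  then show ?thesis
    unfolding translate_def by (intro card_image) (blast intro: inj_on_subset)
qed

lemma half_perimeter_translate [simp]: "half_perimeter (translate t P) = half_perimeter P"
  by (simp add: half_perimeter_def card_translate)

lemma plane_point_add: "plane_point (s + t) = plane_point s + plane_point t"
  by (simp add: plane_point_def)

lemma boundary_translate: "boundary (translate t P) = (+) (plane_point t) ` boundary P"
proof -
  have "convex hull (plane_point ` ((+) t ` e)) = (+) (plane_point t) ` (convex hull (plane_point ` e))" for e
    by (simp add: image_image plane_point_add flip: convex_hull_translation)
  then show ?thesis
    by (auto simp: boundary_def translate_def)
qed

text \<open>The component of \<open>y\<close> in the translated complement, moved back by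
  \<open>- a\<close>, is a connected set through \<open>x\<close> avoiding \<open>S\<close>. Hence
  it lies in the bounded component of \<open>x\<close>. The reverse inclusion is the same fact for
  \<open>- a\<close>.\<close>

lemma inside_translate: "inside ((+) a ` S) = (+) a ` inside S" for S :: "'a::real_normed_vector set"
proof -
  have *: "(+) a ` inside S \<subseteq> inside ((+) a ` S)" for a :: 'a and S
  proof
    fix y assume "y \<in> (+) a ` inside S"
    then obtain x where x: "x \<in> inside S" "y = a + x" by auto
    let ?K = "connected_component_set (- ((+) a ` S)) y"
    have "y \<notin> (+) a ` S" using x by (auto simp: inside_def)
    have "(+) (- a) ` ?K \<subseteq> connected_component_set (- S) x"
    proof (rule connected_component_maximal)
      have "y \<in> ?K" using \<open>y \<notin> _\<close> by (simp add: connected_component_refl_eq)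
      then show "x \<in> (+) (- a) ` ?K" using x(2) by (intro image_eqI[of _ _ y]) simp_all
      show "connected ((+) (- a) ` ?K)"
        by (intro connected_continuous_image connected_connected_component continuous_on_add
              continuous_on_const continuous_on_id)
      show "(+) (- a) ` ?K \<subseteq> - S"
        using connected_component_subset[of "- ((+) a ` S)" y] by force
    qed
    then have "bounded ((+) (- a) ` ?K)"
      using x bounded_subset unfolding inside_def by blast
    then have "bounded ((+) a ` (+) (- a) ` ?K)"
      by (rule bounded_translation)
    then show "y \<in> inside ((+) a ` S)"
      using \<open>y \<notin> _\<close> by (simp add: inside_def image_image)
  qed
  have "inside ((+) a ` S) = (+) a ` (+) (- a) ` inside ((+) a ` S)"
    by (simp add: image_image)
  also have "\<dots> \<subseteq> (+) a ` inside ((+) (- a) ` (+) a ` S)"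
    using *[of "- a" "(+) a ` S"] by blast
  also have "\<dots> = (+) a ` inside S"
    by (simp add: image_image)
  finally show ?thesis
    using *[of a S] by blast
qed

lemma unit_cell_translate: "unit_cell (t + c) = (+) (plane_point t) ` unit_cell c"
proof
  show "unit_cell (t + c) \<subseteq> (+) (plane_point t) ` unit_cell c"
  proof
    fix x assume "x \<in> unit_cell (t + c)"
    then have "x - plane_point t \<in> unit_cell c"
      by (auto simp: unit_cell_def plane_point_def)
    then show "x \<in> (+) (plane_point t) ` unit_cell c"
      by (metis add.commute diff_add_cancel image_eqI)
  qed
qed (auto simp: unit_cell_def plane_point_def)

definition cells :: "polygon \<Rightarrow> point set" where
  "cells P = {c. unit_cell c \<subseteq> inside (boundary P)}"

lemma area_translate [simp]: "area (translate t P) = area P"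
proof -
  have "cells (translate t P) = (+) t ` cells P"
  proof -
    have "c \<in> cells (translate t P) \<longleftrightarrow> c - t \<in> cells P" for c
    proof -
      have "unit_cell c = (+) (plane_point t) ` unit_cell (c - t)"
        using unit_cell_translate[of t "c - t"] by simp
      then show ?thesis
        by (simp add: cells_def boundary_translate inside_translate inj_image_subset_iff)
    qed
    then show ?thesis
      by (force simp: image_iff algebra_simps)
  qed
  then show ?thesis
    by (simp add: area_def card_image flip: cells_def)
qed

section \<open>Edges, vertices and diameter of a polygon\<close>

lemma self_avoiding_polygon_edges:
  assumes "self_avoiding_polygon P"
  shows "finite P" "P \<noteq> {}" "\<And>e. e \<in> P \<Longrightarrow> \<exists>u v. e = {u, v} \<and> adjacent u v"
proof -
  obtain vs where vs: "length vs > 2" "\<And>i. i < length vs \<Longrightarrow> adjacent (vs ! i) (vs ! (Suc i mod length vs))"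
      "P = {{vs ! i, vs ! (Suc i mod length vs)} | i. i < length vs}"
    using assms unfolding self_avoiding_polygon_def by blast
  show "finite P" unfolding vs(3) by simp
  show "P \<noteq> {}" unfolding vs(3) using vs(1) by auto
  show "\<And>e. e \<in> P \<Longrightarrow> \<exists>u v. e = {u, v} \<and> adjacent u v" unfolding vs(3) using vs(2) by blast
qed

text \<open>Each edge contributes at most two vertices; the summand 2 absorbs the rounding in
  \<open>half_perimeter\<close>, since \<open>card P\<close> is at most
  \<open>2 * half_perimeter P + 1\<close>.\<close>

lemma self_avoiding_polygon_vertices:
  assumes "self_avoiding_polygon P"
  shows "finite (\<Union>P)" "\<Union>P \<noteq> {}" "card (\<Union>P) \<le> 4 * half_perimeter P + 2"
proof -
  note e = self_avoiding_polygon_edges[OF assms]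
  show "finite (\<Union>P)" using e by fastforce
  show "\<Union>P \<noteq> {}" using e by fastforce
  have "card (\<Union>P) \<le> (\<Sum>e\<in>P. card e)"
    using card_Union_le_sum_card[of P] by simp
  also have "\<dots> \<le> (\<Sum>e\<in>P. 2)"
    using e(3) by (intro sum_mono) (force intro: order.trans[OF card_insert_le_m1])
  finally show "card (\<Union>P) \<le> 4 * half_perimeter P + 2"
    by (simp add: half_perimeter_def)
qed

text \<open>Along the vertex list each coordinate changes by at most one per step, so a vertex is no
  further from \<open>vs ! 0\<close> than its index. The constant is twice the bound on the number
  of vertices, as two vertices are compared through \<open>vs ! 0\<close>.\<close>

lemma self_avoiding_polygon_diameter:
  assumes "self_avoiding_polygon P" "u \<in> \<Union>P" "v \<in> \<Union>P"
  shows "\<bar>fst u - fst v\<bar> \<le> 8 * int (half_perimeter P) + 4"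
    "\<bar>snd u - snd v\<bar> \<le> 8 * int (half_perimeter P) + 4"
proof -
  obtain vs where vs: "length vs > 2" "distinct vs"
      "\<And>i. i < length vs \<Longrightarrow> adjacent (vs ! i) (vs ! (Suc i mod length vs))"
      "P = {{vs ! i, vs ! (Suc i mod length vs)} | i. i < length vs}"
    using assms(1) unfolding self_avoiding_polygon_def by blast
  have mod: "vs ! (i mod length vs) \<in> set vs" for i
    using vs(1) by (intro nth_mem mod_less_divisor) auto
  have U: "\<Union>P = set vs"
  proof
    show "\<Union>P \<subseteq> set vs" unfolding vs(4) using mod nth_mem by blast
    show "set vs \<subseteq> \<Union>P"
    proof
      fix v assume "v \<in> set vs"
      then obtain i where "i < length vs" "v = vs ! i" by (metis in_set_conv_nth)
      then show "v \<in> \<Union>P" unfolding vs(4) by blast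
    qed
  qed
  have len: "length vs \<le> 4 * half_perimeter P + 2"
    using self_avoiding_polygon_vertices(3)[OF assms(1)] distinct_card[OF vs(2)] U by simp
  have walk: "\<bar>fst (vs ! i) - fst (vs ! 0)\<bar> \<le> int i \<and> \<bar>snd (vs ! i) - snd (vs ! 0)\<bar> \<le> int i"
    if "i < length vs" for i
    using that
  proof (induction i)
    case (Suc i)
    with vs(3)[of i] show ?case
      by (auto simp: adjacent_def)
  qed simp
  obtain i j where "i < length vs" "u = vs ! i" "j < length vs" "v = vs ! j"
    using assms(2,3) U by (auto simp: in_set_conv_nth)
  moreover from this len have "int i + int j \<le> 8 * int (half_perimeter P) + 4" by linarith
  ultimately show "\<bar>fst u - fst v\<bar> \<le> 8 * int (half_perimeter P) + 4"
    "\<bar>snd u - snd v\<bar> \<le> 8 * int (half_perimeter P) + 4"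
    using walk[of i] walk[of j] by auto
qed

section \<open>The boundary curve and its position relative to cells and vertices\<close>

lemma connected_chain:
  fixes S :: "nat \<Rightarrow> 'a::topological_space set"
  assumes "\<And>i. i < n \<Longrightarrow> connected (S i)" "\<And>i. Suc i < n \<Longrightarrow> S i \<inter> S (Suc i) \<noteq> {}"
  shows "connected (\<Union>i<n. S i)"
  using assms
proof (induction n)
  case (Suc n)
  then have IH: "connected (\<Union>i<n. S i)" by simp
  show ?case
  proof (cases n)
    case 0
    with Suc.prems(1)[of 0] show ?thesis by (simp add: lessThan_Suc)
  next
    case (Suc k)
    then have "(\<Union>i<n. S i) \<inter> S n \<noteq> {}"
      using Suc.prems(2)[of k] by auto
    then show ?thesis
      using connected_Un[OF IH Suc.prems(1)[of n]] by (simp add: lessThan_Suc Un_commute)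
  qed
qed simp

lemma connected_boundary:
  assumes "self_avoiding_polygon P"
  shows "connected (boundary P)"
proof -
  obtain vs where vs: "length vs > 2"
      "P = {{vs ! i, vs ! (Suc i mod length vs)} | i. i < length vs}"
    using assms unfolding self_avoiding_polygon_def by blast
  define S where "S i = convex hull (plane_point ` {vs ! i, vs ! (Suc i mod length vs)})" for i
  have "boundary P = (\<Union>i<length vs. S i)"
    unfolding boundary_def vs(2) S_def by blast
  moreover have "connected (\<Union>i<length vs. S i)"
  proof (rule connected_chain)
    fix i assume "Suc i < length vs"
    then have "plane_point (vs ! Suc i) \<in> S i \<inter> S (Suc i)"
      by (auto simp: S_def intro: hull_inc)
    then show "S i \<inter> S (Suc i) \<noteq> {}" by blast
  qed (simp add: S_def convex_connected)
  ultimately show ?thesis by simp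
qed

lemma compact_boundary:
  assumes "self_avoiding_polygon P"
  shows "compact (boundary P)"
  unfolding boundary_def
  using self_avoiding_polygon_edges[OF assms]
  by (intro compact_UN finite_imp_compact_convex_hull) fastforce+

lemma plane_point_vertex_in_boundary: "v \<in> \<Union>P \<Longrightarrow> plane_point v \<in> boundary P"
  unfolding boundary_def by (blast intro: hull_inc)

text \<open>A lattice edge is horizontal or vertical, so one of the differences \<open>p\<close>,
  \<open>q\<close> vanishes and the corresponding coordinate is constant along the edge.\<close>

lemma convex_hull_edge:
  assumes "adjacent u v" "z \<in> convex hull (plane_point ` {u, v})"
  shows "fst z = of_int (fst u) \<or> snd z = of_int (snd u)"
    "\<bar>fst z - of_int (fst u)\<bar> \<le> 1" "\<bar>snd z - of_int (snd u)\<bar> \<le> 1"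
proof -
  have "z \<in> closed_segment (plane_point u) (plane_point v)"
    using assms(2) by (simp add: segment_convex_hull)
  then obtain a where a: "0 \<le> a" "a \<le> 1" "z = (1 - a) *\<^sub>R plane_point u + a *\<^sub>R plane_point v"
    unfolding closed_segment_def by blast
  define p q where "p = fst v - fst u" and "q = snd v - snd u"
  have z: "fst z = of_int (fst u) + a * of_int p" "snd z = of_int (snd u) + a * of_int q"
    unfolding a(3) p_def q_def by (simp_all add: plane_point_def algebra_simps)
  have "\<bar>p\<bar> + \<bar>q\<bar> = 1" using assms(1) by (simp add: adjacent_def p_def q_def abs_minus_commute)
  then consider "p = 0" "\<bar>q\<bar> = 1" | "q = 0" "\<bar>p\<bar> = 1" by linarith
  then have "(p = 0 \<or> q = 0) \<and> \<bar>a * of_int p\<bar> \<le> 1 \<and> \<bar>a * of_int q\<bar> \<le> 1"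
    using a(1,2) by cases (auto simp: abs_mult abs_if split: if_splits)
  then show "fst z = of_int (fst u) \<or> snd z = of_int (snd u)"
    "\<bar>fst z - of_int (fst u)\<bar> \<le> 1" "\<bar>snd z - of_int (snd u)\<bar> \<le> 1"
    using z by auto
qed

text \<open>Every boundary point has an integer coordinate, whereas both coordinates of a point of
  an open cell lie strictly between consecutive integers.\<close>

lemma unit_cell_disjnt_boundary:
  assumes "self_avoiding_polygon P"
  shows "unit_cell c \<inter> boundary P = {}"
proof (rule ccontr)
  assume "unit_cell c \<inter> boundary P \<noteq> {}"
  then obtain z e where "z \<in> unit_cell c" "e \<in> P" "z \<in> convex hull (plane_point ` e)"
    by (auto simp: boundary_def)
  moreover from this obtain u where "fst z = of_int (fst u) \<or> snd z = of_int (snd u)"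
    using self_avoiding_polygon_edges(3)[OF assms] convex_hull_edge(1) by metis
  ultimately obtain i j :: int where "of_int i < (of_int j :: real)" "of_int j < (of_int i :: real) + 1"
    by (auto simp: unit_cell_def)
  then show False
    using of_int_less_iff[of j "i + 1", where 'a = real] by simp
qed

lemma boundary_near_vertex:
  assumes "self_avoiding_polygon P" "z \<in> boundary P"
  obtains u where "u \<in> \<Union>P" "\<bar>fst z - of_int (fst u)\<bar> \<le> 1" "\<bar>snd z - of_int (snd u)\<bar> \<le> 1"
proof -
  obtain e where e: "e \<in> P" "z \<in> convex hull (plane_point ` e)"
    using assms(2) by (auto simp: boundary_def)
  then obtain u v where "e = {u, v}" "adjacent u v"
    using self_avoiding_polygon_edges(3)[OF assms(1)] by blast
  with e that show thesis using convex_hull_edge(2,3) by blast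
qed

lemma connected_subset_inside:
  assumes "connected K" "K \<inter> S = {}" "x \<in> K" "x \<in> inside S"
  shows "K \<subseteq> inside S"
proof
  fix y assume "y \<in> K"
  then have "connected_component (- S) x y"
    using assms unfolding connected_component_def by blast
  then show "y \<in> inside S"
    using assms(4) by (rule inside_same_component)
qed

text \<open>The cell together with its lower left corner lies between the open cell and its closure,
  hence is connected. If the corner is off the boundary, this set avoids the boundary and lies on
  one side of it. This turns statements about lattice points into statements about cells.\<close>

lemma unit_cell_corner_inside_iff:
  assumes "self_avoiding_polygon P" "plane_point c \<notin> boundary P"
  shows "plane_point c \<in> inside (boundary P) \<longleftrightarrow> c \<in> cells P"
proof -
  let ?K = "insert (plane_point c) (unit_cell c)"
  \<comment> \<open>The midpoint witnesses that the cell is nonempty, which is needed to pass from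
    the cell to its corner.\<close>
  define m :: "real \<times> real" where "m = (of_int (fst c) + 1/2, of_int (snd c) + 1/2)"
  have m: "m \<in> unit_cell c" by (simp add: m_def unit_cell_def)
  have conn: "connected ?K"
  proof (rule connected_intermediate_closure[of "unit_cell c"])
    show "connected (unit_cell c)"
      unfolding unit_cell_def by (intro convex_connected convex_Times) simp_all
    show "?K \<subseteq> closure (unit_cell c)"
      using closure_subset by (auto simp: unit_cell_def closure_Times plane_point_def)
  qed auto
  have disj: "?K \<inter> boundary P = {}"
    using unit_cell_disjnt_boundary[OF assms(1)] assms(2) by blast
  show ?thesis
    using connected_subset_inside[OF conn disj, of "plane_point c"]
      connected_subset_inside[OF conn disj, of m] m by (auto simp: cells_def)
qed

lemma finite_cells:
  assumes "self_avoiding_polygon P"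
  shows "finite (cells P)"
proof -
  have "bounded (inside (boundary P))"
    using compact_boundary[OF assms] by (simp add: bounded_inside compact_imp_bounded)
  then obtain B where B: "\<And>x. x \<in> inside (boundary P) \<Longrightarrow> norm x \<le> B"
    unfolding bounded_iff by blast
  have "cells P \<subseteq> {-\<lceil>B\<rceil>-1..\<lceil>B\<rceil>} \<times> {-\<lceil>B\<rceil>-1..\<lceil>B\<rceil>}"
  proof
    fix c assume "c \<in> cells P"
    moreover have "(of_int (fst c) + 1/2, of_int (snd c) + 1/2) \<in> unit_cell c"
      by (simp add: unit_cell_def)
    ultimately have n: "norm (of_int (fst c) + 1/2 :: real, of_int (snd c) + 1/2 :: real) \<le> B"
      using B by (auto simp: cells_def)
    have "\<bar>of_int (fst c) + 1/2 :: real\<bar> \<le> B" "\<bar>of_int (snd c) + 1/2 :: real\<bar> \<le> B"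
      using norm_fst_le[of "of_int (fst c) + 1/2 :: real" "of_int (snd c) + 1/2 :: real"]
        norm_snd_le[of "of_int (snd c) + 1/2 :: real" "of_int (fst c) + 1/2 :: real"] n by auto
    then have "fst c \<in> {-\<lceil>B\<rceil>-1..\<lceil>B\<rceil>}" "snd c \<in> {-\<lceil>B\<rceil>-1..\<lceil>B\<rceil>}"
      by (simp, linarith)+
    then show "c \<in> {-\<lceil>B\<rceil>-1..\<lceil>B\<rceil>} \<times> {-\<lceil>B\<rceil>-1..\<lceil>B\<rceil>}"
      by (simp add: mem_Times_iff)
  qed
  then show ?thesis
    using finite_subset by blast
qed

lemma card_cells: "card (cells P) = area P"
  by (simp add: cells_def area_def)

definition near :: "int \<Rightarrow> point \<Rightarrow> point set" where
  "near d x = {fst x - d..fst x + d} \<times> {snd x - d..snd x + d}"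

lemma finite_near [simp]: "finite (near d x)"
  by (simp add: near_def)

lemma card_near: "card (near d x) = nat (2 * d + 1) ^ 2"
  by (simp add: near_def card_cartesian_product power2_eq_square)

text \<open>A common point is within 1 of a vertex \<open>v\<close> of \<open>P\<close> and within 1
  of a vertex \<open>c + u\<close> of the translated \<open>Q\<close>. As the origin is a vertex of
  \<open>Q\<close>, the coordinates of \<open>u\<close> are bounded by the diameter bound; adding
  \<open>1 + 1\<close> to its constant 4 gives 6.\<close>

lemma boundaries_meet_near:
  assumes P: "self_avoiding_polygon P" and Q: "self_avoiding_polygon Q" "0 \<in> \<Union>Q"
    and meet: "boundary (translate c Q) \<inter> boundary P \<noteq> {}"
  shows "\<exists>v\<in>\<Union>P. c \<in> near (8 * int (half_perimeter Q) + 6) v"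
proof -
  obtain z where z: "z \<in> boundary Q" "plane_point c + z \<in> boundary P"
    using meet unfolding boundary_translate by blast
  obtain v where v: "v \<in> \<Union>P" "\<bar>fst (plane_point c + z) - of_int (fst v)\<bar> \<le> 1"
      "\<bar>snd (plane_point c + z) - of_int (snd v)\<bar> \<le> 1"
    by (rule boundary_near_vertex[OF P z(2)])
  obtain u where u: "u \<in> \<Union>Q" "\<bar>fst z - of_int (fst u)\<bar> \<le> 1" "\<bar>snd z - of_int (snd u)\<bar> \<le> 1"
    by (rule boundary_near_vertex[OF Q(1) z(1)])
  have "\<bar>fst u\<bar> \<le> 8 * int (half_perimeter Q) + 4" "\<bar>snd u\<bar> \<le> 8 * int (half_perimeter Q) + 4"
    using self_avoiding_polygon_diameter[OF Q(1) u(1) Q(2)] by simp_all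
  moreover have "\<bar>of_int (fst c + fst u - fst v) :: real\<bar> \<le> 2" "\<bar>of_int (snd c + snd u - snd v) :: real\<bar> \<le> 2"
    using u v by (auto simp: plane_point_def)
  then have "\<bar>fst c + fst u - fst v\<bar> \<le> 2" "\<bar>snd c + snd u - snd v\<bar> \<le> 2"
    by linarith+
  ultimately have "c \<in> near (8 * int (half_perimeter Q) + 6) v"
    by (auto simp: near_def mem_Times_iff)
  with v(1) show ?thesis by blast
qed

text \<open>Since the origin is a vertex of \<open>Q\<close>, the point \<open>c\<close> lies on the
  translated curve. That curve is connected, so once it avoids the boundary of \<open>P\<close> the
  single point \<open>c\<close> decides whether all of it is inside.\<close>

lemma placed_inside_iff:
  assumes P: "self_avoiding_polygon P" and Q: "self_avoiding_polygon (translate c Q)" "0 \<in> \<Union>Q"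
  shows "boundary (translate c Q) \<subseteq> inside (boundary P) \<longleftrightarrow>
    c \<in> cells P \<and> boundary (translate c Q) \<inter> boundary P = {}"
proof -
  have c: "plane_point c \<in> boundary (translate c Q)"
    using Q(2) unfolding Union_translate
    by (intro plane_point_vertex_in_boundary[of c "translate c Q", unfolded Union_translate] image_eqI[of _ _ 0]) simp_all
  show ?thesis
  proof
    assume sub: "boundary (translate c Q) \<subseteq> inside (boundary P)"
    then have "boundary (translate c Q) \<inter> boundary P = {}"
      using inside_no_overlap[of "boundary P"] by blast
    with sub c show "c \<in> cells P \<and> boundary (translate c Q) \<inter> boundary P = {}"
      using unit_cell_corner_inside_iff[OF P, of c] by blast
  next
    assume *: "c \<in> cells P \<and> boundary (translate c Q) \<inter> boundary P = {}"
    with c have "plane_point c \<in> inside (boundary P)"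
      using unit_cell_corner_inside_iff[OF P, of c] by blast
    with * c show "boundary (translate c Q) \<subseteq> inside (boundary P)"
      using connected_subset_inside[OF connected_boundary[OF Q(1)]] by blast
  qed
qed

section \<open>Counting translation classes\<close>

text \<open>The predicate under \<open>SOME\<close> depends on the translation class of
  \<open>P\<close> only, so the choice is constant on each class.\<close>

definition representative :: "polygon \<Rightarrow> polygon" where
  "representative P = (SOME Q. (\<exists>t. Q = translate t P) \<and> 0 \<in> \<Union>Q)"

definition representatives :: "polygon set \<Rightarrow> polygon set" where
  "representatives C = {P \<in> C. representative P = P}"

lemma representative_translate: "representative (translate t P) = representative P"
proof -
  have "(\<exists>u. Q = translate u (translate t P)) \<longleftrightarrow> (\<exists>u. Q = translate u P)" for Q
  proof
    assume "\<exists>u. Q = translate u P"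
    then obtain u where "Q = translate (u - t) (translate t P)" by (auto simp: translate_translate)
    then show "\<exists>u. Q = translate u (translate t P)" by blast
  qed (metis translate_translate)
  then show ?thesis by (simp add: representative_def)
qed

lemma representative_properties:
  assumes "self_avoiding_polygon P"
  shows "\<exists>t. representative P = translate t P" "0 \<in> \<Union>(representative P)"
proof -
  obtain v where "v \<in> \<Union>P" using self_avoiding_polygon_vertices(2)[OF assms] by blast
  then have "0 \<in> \<Union>(translate (- v) P)"
    unfolding Union_translate by (intro image_eqI[of _ _ v]) simp_all
  then have "(\<exists>t. translate (- v) P = translate t P) \<and> 0 \<in> \<Union>(translate (- v) P)"
    by blast
  then have "(\<exists>t. representative P = translate t P) \<and> 0 \<in> \<Union>(representative P)"
    unfolding representative_def by (rule someI)
  then show "\<exists>t. representative P = translate t P" "0 \<in> \<Union>(representative P)" by blast+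
qed

text \<open>A translation that permutes the finite nonempty vertex set preserves the sum of the
  coordinates, but changes it by \<open>card\<close> times the vector.\<close>

lemma translate_eq_imp_zero:
  assumes "self_avoiding_polygon P" "translate t P = P"
  shows "t = 0"
proof -
  let ?S = "\<Union>P"
  have S: "finite ?S" "?S \<noteq> {}" "(+) t ` ?S = ?S"
    using self_avoiding_polygon_vertices[OF assms(1)] Union_translate[of t P] assms(2) by simp_all
  have inj: "inj_on ((+) t) ?S" by simp
  have "sum fst ?S = (\<Sum>x\<in>?S. fst (t + x))" "sum snd ?S = (\<Sum>x\<in>?S. snd (t + x))"
    using sum.reindex[OF inj, of fst] sum.reindex[OF inj, of snd] S(3) by simp_all
  then have "int (card ?S) * fst t = 0" "int (card ?S) * snd t = 0"
    by (simp_all add: sum.distrib)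
  with S show ?thesis by (auto simp: prod_eq_iff)
qed

context
  fixes C :: "polygon set"
  assumes C: "polygon_class C"
begin

lemma class_self_avoiding: "P \<in> C \<Longrightarrow> self_avoiding_polygon P"
  and class_translate: "P \<in> C \<Longrightarrow> translate t P \<in> C"
  using C unfolding polygon_class_def by blast+

lemma representativesD:
  assumes "P \<in> representatives C"
  shows "P \<in> C" "self_avoiding_polygon P" "0 \<in> \<Union>P"
  using assms class_self_avoiding representative_properties(2)[of P] by (auto simp: representatives_def)

lemma ex_representative:
  assumes "P \<in> C"
  obtains t Q where "Q \<in> representatives C" "P = translate t Q"
proof -
  obtain t where t: "representative P = translate t P"
    using representative_properties(1) class_self_avoiding[OF assms] by blast
  then have "translate t P \<in> representatives C"
    using assms by (simp add: representatives_def class_translate representative_translate)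
  then show thesis
    using that[of "translate t P" "- t"] by simp
qed

text \<open>The shape is recovered by \<open>representative\<close>, which is translation invariant,
  and the vector because a polygon is fixed by no nonzero translation. Holes thus correspond to
  pairs of a shape and a position.\<close>

lemma representatives_unique:
  assumes "Q \<in> representatives C" "R \<in> representatives C" "translate t Q = translate u R"
  shows "Q = R" "t = u"
proof -
  have "representative (translate t Q) = Q" "representative (translate u R) = R"
    using assms(1,2) by (simp_all add: representatives_def representative_translate)
  with assms(3) show "Q = R" by simp
  have "translate (- u + t) Q = Q"
    using arg_cong[OF assms(3), of "translate (- u)"] \<open>Q = R\<close> by (simp add: translate_translate)
  then have "- u + t = 0"
    using translate_eq_imp_zero representativesD(2)[OF assms(1)] by blast
  then show "t = u" by (simp add: add_eq_0_iff)
qed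

text \<open>A representative has the origin as a vertex, so the diameter bound confines all its
  vertices to one square around the origin.\<close>

lemma finite_representatives: "finite {P \<in> representatives C. half_perimeter P \<le> m}"
proof (rule finite_subset)
  show "{P \<in> representatives C. half_perimeter P \<le> m} \<subseteq> Pow (Pow (near (8 * int m + 4) 0))"
  proof clarify
    fix P e v assume P: "P \<in> representatives C" "half_perimeter P \<le> m" "e \<in> P" "v \<in> e"
    then have "v \<in> \<Union>P" by blast
    from self_avoiding_polygon_diameter[OF representativesD(2)[OF P(1)] this representativesD(3)[OF P(1)]] P(2)
    show "v \<in> near (8 * int m + 4) 0"
      by (auto simp: near_def mem_Times_iff)
  qed
qed simp

lemma finite_representatives_eq: "finite {P \<in> representatives C. half_perimeter P = m}"
  by (rule finite_subset[OF _ finite_representatives[of m]]) auto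

end

text \<open>Used to replace the quotients that define the counts by explicit sets of
  representatives.\<close>

lemma card_quotient_transversal:
  assumes "equiv UNIV r" "S \<subseteq> X" "\<And>x. x \<in> X \<Longrightarrow> \<exists>y\<in>S. (x, y) \<in> r"
    and "\<And>y z. y \<in> S \<Longrightarrow> z \<in> S \<Longrightarrow> (y, z) \<in> r \<Longrightarrow> y = z"
  shows "card (X // r) = card S"
proof -
  have "X // r = (\<lambda>y. r `` {y}) ` S"
  proof
    show "X // r \<subseteq> (\<lambda>y. r `` {y}) ` S"
    proof
      fix K assume "K \<in> X // r"
      then obtain x where "x \<in> X" "K = r `` {x}" by (rule quotientE)
      moreover obtain y where "y \<in> S" "(x, y) \<in> r" using assms(3) calculation(1) by blast
      ultimately show "K \<in> (\<lambda>y. r `` {y}) ` S"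
        using equiv_class_eq[OF assms(1)] by (intro image_eqI[of _ _ y]) simp_all
    qed
    show "(\<lambda>y. r `` {y}) ` S \<subseteq> X // r"
      using assms(2) by (intro image_subsetI quotientI) (rule subsetD)
  qed
  moreover have "inj_on (\<lambda>y. r `` {y}) S"
  proof (rule inj_onI)
    fix y z assume "y \<in> S" "z \<in> S" "r `` {y} = r `` {z}"
    then show "y = z" using assms(4) eq_equiv_class[OF _ assms(1), of y z] by blast
  qed
  ultimately show ?thesis by (simp add: card_image)
qed

section \<open>The two translation relations, and moments as finite sums\<close>

lemma polygon_transl_iff: "(P, Q) \<in> polygon_transl \<longleftrightarrow> (\<exists>t. Q = translate t P)"
  by (auto simp: polygon_transl_def)

lemma punctured_transl_iff:
  "((P, H), (Q, K)) \<in> punctured_transl \<longleftrightarrow> (\<exists>t. Q = translate t P \<and> K = translate t ` H)"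
  by (auto simp: punctured_transl_def)

lemma translate_image: "translate s ` translate t ` H = translate (s + t) ` H"
  by (simp add: image_image translate_translate)

lemma equiv_polygon_transl: "equiv UNIV polygon_transl"
proof (rule equivI)
  show "refl polygon_transl"
    by (rule refl_onI) (metis polygon_transl_iff translate_zero)
  show "sym polygon_transl"
    by (rule symI) (metis polygon_transl_iff translate_minus(1))
  show "trans polygon_transl"
    by (rule transI) (metis polygon_transl_iff translate_translate)
qed simp

lemma equiv_punctured_transl: "equiv UNIV punctured_transl"
proof (rule equivI)
  show "refl punctured_transl"
  proof (rule refl_onI)
    fix X show "(X, X) \<in> punctured_transl"
      by (cases X) (auto simp: punctured_transl_iff simp del: split_paired_Ex intro!: exI[of _ 0])
  qed
  show "sym punctured_transl"
  proof (rule symI)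
    fix X Y assume "(X, Y) \<in> punctured_transl"
    then obtain P H t where *: "X = (P, H)" "Y = (translate t P, translate t ` H)"
      by (auto simp: punctured_transl_def)
    show "(Y, X) \<in> punctured_transl"
      unfolding * punctured_transl_iff by (rule exI[of _ "- t"]) (simp add: translate_image)
  qed
  show "trans punctured_transl"
  proof (rule transI)
    fix X Y Z assume "(X, Y) \<in> punctured_transl" "(Y, Z) \<in> punctured_transl"
    then obtain P H t u where *: "X = (P, H)"
        "Z = (translate u (translate t P), translate u ` translate t ` H)"
      by (auto simp: punctured_transl_def)
    show "(X, Z) \<in> punctured_transl"
      unfolding * punctured_transl_iff
      by (rule exI[of _ "u + t"]) (simp add: translate_image translate_translate)
  qed
qed simp

text \<open>The elements of \<open>S\<close> are grouped by the value of \<open>f\<close>, and only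
  finitely many groups are nonempty. The values are integers because a punctured area may be
  negative; negative values match no \<open>int n\<close> and drop out.\<close>

lemma suminf_card_eq_sum:
  fixes f :: "'a \<Rightarrow> int" and g :: "nat \<Rightarrow> real"
  assumes "finite S"
  shows "(\<Sum>n. g n * real (card {x \<in> S. f x = int n})) = (\<Sum>x | x \<in> S \<and> f x \<ge> 0. g (nat (f x)))"
proof -
  let ?S = "{x \<in> S. f x \<ge> 0}" and ?N = "(\<lambda>x. nat (f x)) ` S"
  have "(\<Sum>n. g n * real (card {x \<in> S. f x = int n})) = (\<Sum>n\<in>?N. g n * real (card {x \<in> S. f x = int n}))"
  proof (rule suminf_finite)
    fix n assume "n \<notin> ?N"
    then have "{x \<in> S. f x = int n} = {}" by force
    then show "g n * real (card {x \<in> S. f x = int n}) = 0" by (metis card.empty mult_zero_right of_nat_0)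
  qed (use assms in simp)
  also have "\<dots> = (\<Sum>n\<in>?N. \<Sum>x\<in>{x \<in> ?S. nat (f x) = n}. g (nat (f x)))"
  proof (rule sum.cong)
    fix n
    have "{x \<in> S. f x = int n} = {x \<in> ?S. nat (f x) = n}" by auto
    then show "g n * real (card {x \<in> S. f x = int n}) = (\<Sum>x\<in>{x \<in> ?S. nat (f x) = n}. g (nat (f x)))"
      by simp
  qed simp
  also have "\<dots> = (\<Sum>x\<in>?S. g (nat (f x)))"
    using assms by (intro sum.group) auto
  finally show ?thesis by simp
qed

context
  fixes C :: "polygon set"
  assumes C: "polygon_class C"
begin

lemma poly_count_eq: "poly_count C m n = card {P \<in> representatives C. half_perimeter P = m \<and> area P = n}"
  unfolding poly_count_def
proof (rule card_quotient_transversal[OF equiv_polygon_transl])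
  fix P assume "P \<in> {P \<in> C. half_perimeter P = m \<and> area P = n}"
  moreover obtain t Q where "Q \<in> representatives C" "P = translate t Q"
    using ex_representative[OF C] calculation by blast
  ultimately show "\<exists>Q\<in>{P \<in> representatives C. half_perimeter P = m \<and> area P = n}. (P, Q) \<in> polygon_transl"
    by (intro bexI[of _ Q]) (auto simp: polygon_transl_iff simp del: split_paired_Ex intro!: exI[of _ "- t"])
next
  fix P Q assume *: "P \<in> {P \<in> representatives C. half_perimeter P = m \<and> area P = n}"
    "Q \<in> {P \<in> representatives C. half_perimeter P = m \<and> area P = n}" "(P, Q) \<in> polygon_transl"
  then obtain t where "translate 0 Q = translate t P" by (auto simp: polygon_transl_iff)
  with * show "P = Q" using representatives_unique(1)[OF C, of Q P 0 t] by auto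
qed (auto simp: representatives_def)

lemma poly_moment_eq: "poly_moment C k m = (\<Sum>P | P \<in> representatives C \<and> half_perimeter P = m. real (area P) ^ k)"
proof -
  let ?R = "{P \<in> representatives C. half_perimeter P = m}"
  have "{P \<in> representatives C. half_perimeter P = m \<and> area P = n} = {P \<in> ?R. int (area P) = int n}" for n
    by auto
  then have "poly_moment C k m = (\<Sum>n. real n ^ k * real (card {P \<in> ?R. int (area P) = int n}))"
    unfolding poly_moment_def poly_count_eq by presburger
  also have "\<dots> = (\<Sum>P | P \<in> ?R \<and> int (area P) \<ge> 0. real (nat (int (area P))) ^ k)"
    by (rule suminf_card_eq_sum[OF finite_representatives_eq[OF C]])
  finally show ?thesis by simp
qed

lemma poly_total_eq: "poly_total C m = real (card {P \<in> representatives C. half_perimeter P = m})"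
proof -
  have "poly_total C m = poly_moment C 0 m"
    by (simp add: poly_moment_def poly_total_def)
  then show ?thesis
    by (simp add: poly_moment_eq)
qed

end

section \<open>Placing the holes\<close>

lemma fps_nth_power_card:
  fixes h :: "'a \<Rightarrow> nat"
  assumes "\<And>m. finite {x \<in> S. h x = m}"
  defines "L \<equiv> \<lambda>r s. {xs. set xs \<subseteq> S \<and> length xs = r \<and> sum_list (map h xs) = s}"
  shows "finite (L r s)"
    and "fps_nth (Abs_fps (\<lambda>m. of_nat (card {x \<in> S. h x = m})) ^ r) s = (of_nat (card (L r s)) :: 'b::comm_semiring_1)"
proof -
  let ?F = "Abs_fps (\<lambda>m. of_nat (card {x \<in> S. h x = m})) :: 'b fps"
  have "finite (L r s) \<and> fps_nth (?F ^ r) s = of_nat (card (L r s))"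
  proof (induction r arbitrary: s)
    case 0
    have "L 0 s = (if s = 0 then {[]} else {})" by (auto simp: L_def)
    then show ?case by simp
  next
    case (Suc r)
    \<comment> \<open>Splitting off the head, of size \<open>i\<close>, mirrors the Cauchy product
      of one factor with the remaining power.\<close>
    let ?X = "SIGMA i:{0..s}. {x \<in> S. h x = i} \<times> L r (s - i)"
    have bij: "bij_betw (\<lambda>(i, x, xs). x # xs) ?X (L (Suc r) s)"
      by (rule bij_betw_byWitness[where f' = "\<lambda>xs. (h (hd xs), hd xs, tl xs)"])
         (auto simp: L_def length_Suc_conv)
    have fin: "finite ?X" using Suc.IH assms(1) by auto
    have "fps_nth (?F ^ Suc r) s = (\<Sum>i=0..s. of_nat (card ({x \<in> S. h x = i} \<times> L r (s - i))))"
      using Suc.IH by (simp add: fps_mult_nth card_cartesian_product)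
    also have "\<dots> = of_nat (card ?X)"
      using Suc.IH assms(1) by (subst card_SigmaI) auto
    finally show ?case
      using bij_betw_finite[OF bij] bij_betw_same_card[OF bij] fin by simp
  qed
  then show "finite (L r s)" "fps_nth (?F ^ r) s = of_nat (card (L r s))" by blast+
qed

text \<open>A union bound over the offending position \<open>i\<close>: the other
  \<open>r - 1\<close> entries are free, and given these the offending one has at most
  \<open>b\<close> values. One factor \<open>card A\<close> is thereby traded for
  \<open>r * b\<close>.\<close>

lemma card_lists_bad_position:
  assumes "finite A"
    and B: "\<And>ys. length ys = r - 1 \<Longrightarrow> finite (B ys) \<and> card (B ys) \<le> b"
  shows "card {cs. set cs \<subseteq> A \<and> length cs = r \<and> (\<exists>i<r. cs ! i \<in> B (take i cs @ drop (Suc i) cs))}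
    \<le> r * (card A ^ (r - 1) * b)"
proof -
  let ?L = "{ys. set ys \<subseteq> A \<and> length ys = r - 1}"
  \<comment> \<open>The map reinserts the removed entry \<open>c\<close> at position
    \<open>i\<close>.\<close>
  let ?W = "\<lambda>i. (\<lambda>(ys, c). take i ys @ c # drop i ys) ` (SIGMA ys:?L. B ys)"
  have finL: "finite ?L" using assms(1) by (rule finite_lists_length_eq)
  have finS: "finite (SIGMA ys:?L. B ys)" using finL B by auto
  have "{cs. set cs \<subseteq> A \<and> length cs = r \<and> (\<exists>i<r. cs ! i \<in> B (take i cs @ drop (Suc i) cs))} \<subseteq> (\<Union>i<r. ?W i)"
  proof clarify
    fix cs i assume *: "set cs \<subseteq> A" "i < length cs" "cs ! i \<in> B (take i cs @ drop (Suc i) cs)" "r = length cs"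
    let ?ys = "take i cs @ drop (Suc i) cs"
    have len: "length ?ys = r - 1" using *(2,4) by simp
    have "set ?ys \<subseteq> A"
      using *(1) set_take_subset[of i cs] set_drop_subset[of "Suc i" cs] unfolding set_append by blast
    with len *(3) have "(?ys, cs ! i) \<in> (SIGMA ys:?L. B ys)" by blast
    moreover have "cs = take i ?ys @ cs ! i # drop i ?ys"
      using *(2) id_take_nth_drop[of i cs] by simp
    ultimately have "cs \<in> ?W i"
      by (intro image_eqI[of _ _ "(?ys, cs ! i)"]) simp_all
    then show "cs \<in> (\<Union>i<length cs. (\<lambda>(ys, c). take i ys @ c # drop i ys) ` (SIGMA ys:{ys. set ys \<subseteq> A \<and> length ys = length cs - 1}. B ys))"
      using *(2,4) by blast
  qed
  then have "card {cs. set cs \<subseteq> A \<and> length cs = r \<and> (\<exists>i<r. cs ! i \<in> B (take i cs @ drop (Suc i) cs))} \<le> card (\<Union>i<r. ?W i)"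
    using finS by (intro card_mono) auto
  also have "\<dots> \<le> (\<Sum>i<r. card (?W i))" by (rule card_UN_le) simp
  also have "\<dots> \<le> (\<Sum>i<r. card (SIGMA ys:?L. B ys))"
    using finS by (intro sum_mono card_image_le)
  also have "card (SIGMA ys:?L. B ys) = (\<Sum>ys\<in>?L. card (B ys))"
    using finL B by (intro card_SigmaI) auto
  also have "(\<Sum>ys\<in>?L. card (B ys)) \<le> card ?L * b"
    using sum_bounded_above[of ?L "\<lambda>ys. card (B ys)" b] B by simp
  also have "card ?L = card A ^ (r - 1)" using assms(1) by (rule card_lists_length_eq)
  finally show ?thesis by simp
qed

lemma near_mono: "d \<le> e \<Longrightarrow> near d x \<subseteq> near e x"
  by (auto simp: near_def)

lemma nth_in_set_remove_nth:
  assumes "i < length xs" "j < length xs" "i \<noteq> j"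
  shows "xs ! j \<in> set (take i xs @ drop (Suc i) xs)"
proof (cases "j < i")
  case True
  then have "take i xs ! j = xs ! j" "j < length (take i xs)" using assms by simp_all
  then have "xs ! j \<in> set (take i xs)" by (metis nth_mem)
  then show ?thesis by simp
next
  case False
  then have "drop (Suc i) xs ! (j - Suc i) = xs ! j" "j - Suc i < length (drop (Suc i) xs)"
    using assms by simp_all
  then have "xs ! j \<in> set (drop (Suc i) xs)" by (metis nth_mem)
  then show ?thesis by simp
qed

text \<open>The entries of \<open>cs\<close> are both cells of \<open>P\<close> and the translation
  vectors of the holes. By \<open>placed_inside_iff\<close>, membership in \<open>cells P\<close>
  and disjointness from the boundary of \<open>P\<close> together say that the hole is inside
  \<open>P\<close>.\<close>

definition placements :: "polygon \<Rightarrow> polygon list \<Rightarrow> point list set" where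
  "placements P qs = {cs. length cs = length qs \<and> set cs \<subseteq> cells P \<and>
     (\<forall>i<length qs. boundary (translate (cs ! i) (qs ! i)) \<inter> boundary P = {}) \<and>
     (\<forall>i<length qs. \<forall>j<length qs. i \<noteq> j \<longrightarrow>
        boundary (translate (cs ! i) (qs ! i)) \<inter> boundary (translate (cs ! j) (qs ! j)) = {})}"

definition hole_types :: "polygon set \<Rightarrow> nat \<Rightarrow> nat \<Rightarrow> polygon list set" where
  "hole_types C r s = {qs. set qs \<subseteq> representatives C \<and> length qs = r \<and> sum_list (map half_perimeter qs) = s}"

text \<open>Ordering the holes lets shapes and positions be chosen entry by entry; the factor
  \<open>fact r\<close> is divided out afterwards.\<close>

definition hole_lists :: "polygon set \<Rightarrow> polygon \<Rightarrow> nat \<Rightarrow> nat \<Rightarrow> polygon list set" where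
  "hole_lists C P r s = {ys. length ys = r \<and> set ys \<subseteq> C \<and> distinct ys \<and>
     (\<forall>y\<in>set ys. boundary y \<subseteq> inside (boundary P)) \<and>
     pairwise (\<lambda>Q R. disjnt (boundary Q) (boundary R)) (set ys) \<and>
     sum_list (map half_perimeter ys) = s}"

definition hole_sets :: "polygon set \<Rightarrow> polygon \<Rightarrow> nat \<Rightarrow> nat \<Rightarrow> polygon set set" where
  "hole_sets C P r s = {H. H \<subseteq> C \<and> finite H \<and> card H = r \<and>
     (\<forall>Q\<in>H. boundary Q \<subseteq> inside (boundary P)) \<and>
     pairwise (\<lambda>Q R. disjnt (boundary Q) (boundary R)) H \<and>
     (\<Sum>Q\<in>H. half_perimeter Q) = s}"

lemma finite_placements:
  assumes "self_avoiding_polygon P"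
  shows "finite (placements P qs)" "card (placements P qs) \<le> area P ^ length qs"
proof -
  let ?L = "{cs. set cs \<subseteq> cells P \<and> length cs = length qs}"
  have fin: "finite ?L" using finite_cells[OF assms] by (rule finite_lists_length_eq)
  have sub: "placements P qs \<subseteq> ?L" by (auto simp: placements_def)
  show "finite (placements P qs)" using fin sub by (rule finite_subset[rotated])
  have "card (placements P qs) \<le> card ?L" using fin sub by (rule card_mono)
  then show "card (placements P qs) \<le> area P ^ length qs"
    using card_lists_length_eq[OF finite_cells[OF assms], of "length qs"] by (simp add: card_cells)
qed

text \<open>An arbitrary list of cells fails to be a placement only if one of its members is close to
  a vertex of the outer polygon or to another member, which costs one factor of the area.\<close>

lemma card_placements_ge:
  assumes C: "polygon_class C" and P: "self_avoiding_polygon P" and qs: "qs \<in> hole_types C r s"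
  shows "area P ^ r \<le> card (placements P qs) +
    r * (area P ^ (r - 1) * ((4 * half_perimeter P + 2 + r) * (32 * s + 21) ^ 2))"
proof -
  \<comment> \<open>Two colliding holes have positions within
    \<open>(8 * s + 6) + (8 * s + 4)\<close>, by \<open>boundaries_meet_near\<close> and the
    diameter of the second hole; this also covers collisions with \<open>P\<close>. A square of
    radius \<open>D\<close> has \<open>(32 * s + 21) ^ 2\<close> points, and
    \<open>4 * half_perimeter P + 2 + r\<close> bounds the number of centres.\<close>
  define D where "D = 16 * int s + 10"
  define B where "B ys = (\<Union>v\<in>\<Union>P \<union> set ys. near D v)" for ys :: "point list"
  define b where "b = (4 * half_perimeter P + 2 + r) * (32 * s + 21) ^ 2"
  let ?L = "{cs. set cs \<subseteq> cells P \<and> length cs = r}"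
  let ?bad = "{cs. set cs \<subseteq> cells P \<and> length cs = r \<and> (\<exists>i<r. cs ! i \<in> B (take i cs @ drop (Suc i) cs))}"
  have len: "length qs = r" using qs by (simp add: hole_types_def)
  have B: "finite (B ys) \<and> card (B ys) \<le> b" if "length ys = r - 1" for ys
  proof -
    have fin: "finite (\<Union>P \<union> set ys)" using self_avoiding_polygon_vertices(1)[OF P] by simp
    have "card (\<Union>P \<union> set ys) \<le> card (\<Union>P) + card (set ys)" by (rule card_Un_le)
    also have "\<dots> \<le> 4 * half_perimeter P + 2 + r"
      using self_avoiding_polygon_vertices(3)[OF P] card_length[of ys] that by linarith
    finally have c: "card (\<Union>P \<union> set ys) \<le> 4 * half_perimeter P + 2 + r" .
    have "card (B ys) \<le> (\<Sum>v\<in>\<Union>P \<union> set ys. card (near D v))"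
      unfolding B_def using fin by (rule card_UN_le)
    also have "\<dots> = card (\<Union>P \<union> set ys) * nat (2 * D + 1) ^ 2"
      by (simp add: card_near)
    also have "nat (2 * D + 1) = 32 * s + 21"
      by (simp add: D_def nat_add_distrib nat_mult_distrib)
    finally have "card (B ys) \<le> card (\<Union>P \<union> set ys) * (32 * s + 21) ^ 2" .
    also have "\<dots> \<le> b" unfolding b_def using c by (rule mult_le_mono1)
    finally have "card (B ys) \<le> b" .
    moreover have "finite (B ys)" unfolding B_def using fin by (rule finite_UN_I) simp
    ultimately show ?thesis by simp
  qed
  have q: "self_avoiding_polygon (qs ! i)" "0 \<in> \<Union>(qs ! i)" "half_perimeter (qs ! i) \<le> s"
      "self_avoiding_polygon (translate c (qs ! i))" if "i < r" for i c
  proof -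
    have *: "qs ! i \<in> set qs" "set qs \<subseteq> representatives C" "sum_list (map half_perimeter qs) = s"
      using qs that by (auto simp: hole_types_def)
    then have rep: "qs ! i \<in> representatives C" by blast
    show "self_avoiding_polygon (qs ! i)" "0 \<in> \<Union>(qs ! i)"
      using representativesD[OF C rep] by simp_all
    show "self_avoiding_polygon (translate c (qs ! i))"
      using representativesD[OF C rep] class_translate[OF C] class_self_avoiding[OF C] by blast
    show "half_perimeter (qs ! i) \<le> s"
      using member_le_sum_list[of "half_perimeter (qs ! i)" "map half_perimeter qs"] * by simp
  qed
  have "?L - placements P qs \<subseteq> ?bad"
  proof
    fix cs assume cs: "cs \<in> ?L - placements P qs"
    then have cs': "set cs \<subseteq> cells P" "length cs = r" by simp_all
    consider i where "i < r" "boundary (translate (cs ! i) (qs ! i)) \<inter> boundary P \<noteq> {}"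
      | i j where "i < r" "j < r" "i \<noteq> j"
        "boundary (translate (cs ! i) (qs ! i)) \<inter> boundary (translate (cs ! j) (qs ! j)) \<noteq> {}"
    proof -
      have "cs \<notin> placements P qs" using cs by blast
      then have "\<not> ((\<forall>i<r. boundary (translate (cs ! i) (qs ! i)) \<inter> boundary P = {}) \<and>
        (\<forall>i<r. \<forall>j<r. i \<noteq> j \<longrightarrow>
          boundary (translate (cs ! i) (qs ! i)) \<inter> boundary (translate (cs ! j) (qs ! j)) = {}))"
        unfolding placements_def using cs' len by simp
      then show thesis using that by meson
    qed
    then have "\<exists>i<r. cs ! i \<in> B (take i cs @ drop (Suc i) cs)"
    proof cases
      case 1
      obtain v where v: "v \<in> \<Union>P" "cs ! i \<in> near (8 * int (half_perimeter (qs ! i)) + 6) v"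
        using boundaries_meet_near[OF P q(1,2)[OF 1(1)] 1(2)] by blast
      have "8 * int (half_perimeter (qs ! i)) + 6 \<le> D"
        using q(3)[OF 1(1)] by (simp add: D_def)
      then have "cs ! i \<in> near D v" using v(2) near_mono by blast
      then show ?thesis using v(1) 1(1) unfolding B_def by blast
    next
      case 2
      obtain v where v: "v \<in> \<Union>(translate (cs ! j) (qs ! j))"
          "cs ! i \<in> near (8 * int (half_perimeter (qs ! i)) + 6) v"
        using boundaries_meet_near[OF q(4)[OF 2(2)] q(1,2)[OF 2(1)] 2(4)] by blast
      obtain w where w: "w \<in> \<Union>(qs ! j)" "v = cs ! j + w"
        using v(1) unfolding Union_translate by blast
      have "\<bar>fst w\<bar> \<le> 8 * int (half_perimeter (qs ! j)) + 4" "\<bar>snd w\<bar> \<le> 8 * int (half_perimeter (qs ! j)) + 4"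
        using self_avoiding_polygon_diameter[OF q(1)[OF 2(2)] w(1) q(2)[OF 2(2)]] by simp_all
      moreover have "int (half_perimeter (qs ! i)) \<le> int s" "int (half_perimeter (qs ! j)) \<le> int s"
        using q(3)[OF 2(1)] q(3)[OF 2(2)] by simp_all
      ultimately have "cs ! i \<in> near D (cs ! j)"
        using v(2) unfolding w(2) near_def D_def mem_Times_iff by auto
      moreover have "cs ! j \<in> set (take i cs @ drop (Suc i) cs)"
        using 2 cs' by (intro nth_in_set_remove_nth) simp_all
      ultimately show ?thesis using 2(1) unfolding B_def by blast
    qed
    with cs' show "cs \<in> ?bad" by blast
  qed
  moreover have finL: "finite ?L" using finite_cells[OF P] by (rule finite_lists_length_eq)
  moreover from finL have "finite ?bad" by (rule finite_subset[rotated]) blast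
  moreover have "card ?bad \<le> r * (card (cells P) ^ (r - 1) * b)"
    using finite_cells[OF P] B by (rule card_lists_bad_position)
  ultimately have "card (?L - placements P qs) \<le> r * (area P ^ (r - 1) * b)"
    by (metis (no_types, lifting) card_cells card_mono order_trans)
  moreover have "card ?L = area P ^ r"
    using card_lists_length_eq[OF finite_cells[OF P], of r] by (simp add: card_cells)
  moreover have "card ?L - card (placements P qs) \<le> card (?L - placements P qs)"
    using finite_placements(1)[OF P] by (rule diff_card_le_card_Diff)
  ultimately show ?thesis unfolding b_def by linarith
qed

text \<open>Equal entries at two different indices would be disjoint from themselves, hence empty;
  so disjointness by index already forces distinctness.\<close>

lemma distinct_pairwise_disjnt_iff:
  assumes "\<And>y. y \<in> set ys \<Longrightarrow> f y \<noteq> {}"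
  shows "distinct ys \<and> pairwise (\<lambda>Q R. disjnt (f Q) (f R)) (set ys) \<longleftrightarrow>
    (\<forall>i<length ys. \<forall>j<length ys. i \<noteq> j \<longrightarrow> f (ys ! i) \<inter> f (ys ! j) = {})" (is "?l \<longleftrightarrow> ?r")
proof
  assume ?l
  then show ?r
    unfolding pairwise_def disjnt_def distinct_conv_nth by (meson nth_mem)
next
  assume r: ?r
  then have "distinct ys"
    unfolding distinct_conv_nth using assms by (metis inf.idem nth_mem)
  moreover have "pairwise (\<lambda>Q R. disjnt (f Q) (f R)) (set ys)"
    using r unfolding pairwise_def disjnt_def by (metis in_set_conv_nth)
  ultimately show ?l ..
qed

text \<open>Every hole is a unique translate of a unique representative, which gives injectivity and
  surjectivity; \<open>placed_inside_iff\<close> matches the geometric conditions.\<close>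

lemma bij_betw_hole_lists:
  assumes C: "polygon_class C" and P: "self_avoiding_polygon P"
  shows "bij_betw (\<lambda>(qs, cs). map2 translate cs qs) (SIGMA qs:hole_types C r s. placements P qs) (hole_lists C P r s)"
proof -
  have nonempty: "boundary y \<noteq> {}" if y: "y \<in> C" for y
  proof -
    obtain v where "v \<in> \<Union>y"
      using self_avoiding_polygon_vertices(2)[OF class_self_avoiding[OF C y]] by blast
    then show ?thesis using plane_point_vertex_in_boundary by blast
  qed
  \<comment> \<open>With shapes and vectors of the right length fixed, the conditions on both sides
    correspond one by one. Well-definedness and surjectivity both follow from this.\<close>
  have iff: "map2 translate cs qs \<in> hole_lists C P r s \<longleftrightarrow> qs \<in> hole_types C r s \<and> cs \<in> placements P qs"
    if qs: "set qs \<subseteq> representatives C" and len: "length qs = r" "length cs = r" for qs cs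
  proof -
    let ?ys = "map2 translate cs qs"
    have ys: "length ?ys = r" "\<And>i. i < r \<Longrightarrow> ?ys ! i = translate (cs ! i) (qs ! i)"
      using len by simp_all
    have inC: "translate (cs ! i) (qs ! i) \<in> C" if "i < r" for i
    proof -
      have "qs ! i \<in> representatives C" using that len qs nth_mem by blast
      then show ?thesis using representativesD(1)[OF C] class_translate[OF C] by blast
    qed
    have sub: "set ?ys \<subseteq> C"
      using inC ys by (metis in_set_conv_nth subsetI)
    have hp: "map half_perimeter ?ys = map half_perimeter qs"
      using ys len by (intro nth_equalityI) simp_all
    have inside: "(\<forall>y\<in>set ?ys. boundary y \<subseteq> inside (boundary P)) \<longleftrightarrow>
      set cs \<subseteq> cells P \<and> (\<forall>i<r. boundary (translate (cs ! i) (qs ! i)) \<inter> boundary P = {})"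
    proof -
      have "(\<forall>y\<in>set ?ys. boundary y \<subseteq> inside (boundary P)) \<longleftrightarrow>
        (\<forall>i<r. boundary (translate (cs ! i) (qs ! i)) \<subseteq> inside (boundary P))"
        unfolding all_set_conv_all_nth using ys by simp
      also have "\<dots> \<longleftrightarrow> (\<forall>i<r. cs ! i \<in> cells P \<and> boundary (translate (cs ! i) (qs ! i)) \<inter> boundary P = {})"
      proof -
        have "boundary (translate (cs ! i) (qs ! i)) \<subseteq> inside (boundary P) \<longleftrightarrow>
          cs ! i \<in> cells P \<and> boundary (translate (cs ! i) (qs ! i)) \<inter> boundary P = {}" if "i < r" for i
        proof (rule placed_inside_iff[OF P])
          have "qs ! i \<in> representatives C" using that len qs nth_mem by blast
          then show "0 \<in> \<Union>(qs ! i)" by (rule representativesD(3)[OF C])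
        qed (use inC[OF that] class_self_avoiding[OF C] in blast)
        then show ?thesis by blast
      qed
      also have "\<dots> \<longleftrightarrow> set cs \<subseteq> cells P \<and> (\<forall>i<r. boundary (translate (cs ! i) (qs ! i)) \<inter> boundary P = {})"
        unfolding subset_code(1) all_set_conv_all_nth len(2) by blast
      finally show ?thesis .
    qed
    have disjoint: "distinct ?ys \<and> pairwise (\<lambda>Q R. disjnt (boundary Q) (boundary R)) (set ?ys) \<longleftrightarrow>
      (\<forall>i<r. \<forall>j<r. i \<noteq> j \<longrightarrow>
        boundary (translate (cs ! i) (qs ! i)) \<inter> boundary (translate (cs ! j) (qs ! j)) = {})"
    proof -
      have "boundary y \<noteq> {}" if "y \<in> set ?ys" for y using that sub nonempty by blast
      note distinct_pairwise_disjnt_iff[of ?ys boundary, OF this, unfolded ys(1)]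
      also have "(\<forall>i<r. \<forall>j<r. i \<noteq> j \<longrightarrow> boundary (?ys ! i) \<inter> boundary (?ys ! j) = {}) \<longleftrightarrow>
        (\<forall>i<r. \<forall>j<r. i \<noteq> j \<longrightarrow>
          boundary (translate (cs ! i) (qs ! i)) \<inter> boundary (translate (cs ! j) (qs ! j)) = {})"
        by (intro all_cong1 imp_cong refl) (simp_all only: ys(2))
      finally show ?thesis .
    qed
    have "?ys \<in> hole_lists C P r s \<longleftrightarrow>
      (distinct ?ys \<and> pairwise (\<lambda>Q R. disjnt (boundary Q) (boundary R)) (set ?ys)) \<and>
      (\<forall>y\<in>set ?ys. boundary y \<subseteq> inside (boundary P)) \<and> sum_list (map half_perimeter qs) = s"
      unfolding hole_lists_def mem_Collect_eq hp using ys(1) sub by argo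
    also have "\<dots> \<longleftrightarrow> qs \<in> hole_types C r s \<and> cs \<in> placements P qs"
      unfolding inside disjoint hole_types_def placements_def mem_Collect_eq len using qs by argo
    finally show ?thesis .
  qed
  show ?thesis
  proof (rule bij_betwI')
    fix X Y assume X: "X \<in> (SIGMA qs:hole_types C r s. placements P qs)" and Y: "Y \<in> (SIGMA qs:hole_types C r s. placements P qs)"
    obtain qs cs where X': "X = (qs, cs)" by (cases X)
    obtain qs' cs' where Y': "Y = (qs', cs')" by (cases Y)
    have len: "length qs = r" "length cs = r" "length qs' = r" "length cs' = r"
      and reps: "set qs \<subseteq> representatives C" "set qs' \<subseteq> representatives C"
      using X Y unfolding X' Y' by (auto simp: hole_types_def placements_def)
    have "qs = qs' \<and> cs = cs'" if eq: "map2 translate cs qs = map2 translate cs' qs'"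
    proof -
      have *: "qs ! i = qs' ! i \<and> cs ! i = cs' ! i" if "i < r" for i
      proof -
        have "translate (cs ! i) (qs ! i) = translate (cs' ! i) (qs' ! i)"
          using arg_cong[OF eq, of "\<lambda>ys. ys ! i"] that len by simp
        moreover have "qs ! i \<in> representatives C" "qs' ! i \<in> representatives C"
          using that len by (intro subsetD[OF reps(1)] subsetD[OF reps(2)] nth_mem; simp)+
        ultimately show ?thesis
          using representatives_unique[OF C, of "qs ! i" "qs' ! i" "cs ! i" "cs' ! i"] by simp
      qed
      then show ?thesis using len by (simp add: list_eq_iff_nth_eq)
    qed
    then show "(case X of (qs, cs) \<Rightarrow> map2 translate cs qs) = (case Y of (qs, cs) \<Rightarrow> map2 translate cs qs) \<longleftrightarrow> X = Y"
      unfolding X' Y' prod.case prod.inject by blast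
  next
    fix X assume "X \<in> (SIGMA qs:hole_types C r s. placements P qs)"
    then obtain qs cs where X: "X = (qs, cs)" "qs \<in> hole_types C r s" "cs \<in> placements P qs" by blast
    then have "set qs \<subseteq> representatives C" "length qs = r" "length cs = r"
      by (simp_all add: hole_types_def placements_def)
    from iff[OF this] X show "(case X of (qs, cs) \<Rightarrow> map2 translate cs qs) \<in> hole_lists C P r s"
      by simp
  next
    fix ys assume ys: "ys \<in> hole_lists C P r s"
    then have sub: "set ys \<subseteq> C" and len: "length ys = r" by (simp_all add: hole_lists_def)
    have "\<exists>t Q. Q \<in> representatives C \<and> y = translate t Q" if "y \<in> C" for y
      using ex_representative[OF C that] by blast
    then obtain f g where fg: "\<And>y. y \<in> C \<Longrightarrow> g y \<in> representatives C \<and> y = translate (f y) (g y)"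
      by metis
    have eq: "map2 translate (map f ys) (map g ys) = ys"
    proof (rule nth_equalityI)
      fix i assume "i < length (map2 translate (map f ys) (map g ys))"
      then have "i < length ys" by simp
      moreover from this have "ys ! i \<in> C" using sub nth_mem by blast
      ultimately show "map2 translate (map f ys) (map g ys) ! i = ys ! i"
        using fg[of "ys ! i"] by simp
    qed simp
    have "set (map g ys) \<subseteq> representatives C" using sub fg by auto
    from iff[OF this, of "map f ys"] len
    have "map g ys \<in> hole_types C r s \<and> map f ys \<in> placements P (map g ys)"
      unfolding eq using ys by simp
    then show "\<exists>X\<in>SIGMA qs:hole_types C r s. placements P qs. ys = (case X of (qs, cs) \<Rightarrow> map2 translate cs qs)"
      using eq by (intro bexI[of _ "(map g ys, map f ys)"]) simp_all
  qed
qed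

lemma
  assumes C: "polygon_class C"
  shows finite_hole_types: "finite (hole_types C r s)"
    and fps_nth_poly_gf_power: "fps_nth (poly_gf C ^ r) s = real (card (hole_types C r s))"
proof -
  have gf: "poly_gf C = Abs_fps (\<lambda>m. of_nat (card {P \<in> representatives C. half_perimeter P = m}))"
    unfolding poly_gf_def by (intro arg_cong[of _ _ Abs_fps] ext) (rule poly_total_eq[OF C])
  show "finite (hole_types C r s)"
    unfolding hole_types_def using finite_representatives_eq[OF C] by (rule fps_nth_power_card(1))
  show "fps_nth (poly_gf C ^ r) s = real (card (hole_types C r s))"
    unfolding gf hole_types_def using finite_representatives_eq[OF C] by (rule fps_nth_power_card(2))
qed

lemma finite_hole_lists:
  assumes "polygon_class C" "self_avoiding_polygon P"
  shows "finite (hole_lists C P r s)"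
  using bij_betw_finite[OF bij_betw_hole_lists[OF assms, of r s]]
    finite_hole_types[OF assms(1)] finite_placements(1)[OF assms(2)] by simp

text \<open>Hole areas depend on the shapes alone, so the sum over placements collapses to their
  number.\<close>

lemma sum_hole_lists:
  fixes g :: "nat \<Rightarrow> real"
  assumes C: "polygon_class C" and P: "self_avoiding_polygon P"
  shows "(\<Sum>ys\<in>hole_lists C P r s. g (sum_list (map area ys))) =
    (\<Sum>qs\<in>hole_types C r s. real (card (placements P qs)) * g (sum_list (map area qs)))"
proof -
  have "(\<Sum>ys\<in>hole_lists C P r s. g (sum_list (map area ys))) =
    (\<Sum>(qs, cs)\<in>(SIGMA qs:hole_types C r s. placements P qs). g (sum_list (map area (map2 translate cs qs))))"
    by (subst sum.reindex_bij_betw[OF bij_betw_hole_lists[OF C P], symmetric]) (simp add: case_prod_beta)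
  also have "\<dots> = (\<Sum>qs\<in>hole_types C r s. \<Sum>cs\<in>placements P qs. g (sum_list (map area (map2 translate cs qs))))"
    using finite_hole_types[OF C] finite_placements(1)[OF P] by (intro sum.Sigma[symmetric]) auto
  also have "\<dots> = (\<Sum>qs\<in>hole_types C r s. \<Sum>cs\<in>placements P qs. g (sum_list (map area qs)))"
  proof (intro sum.cong refl)
    fix qs cs assume "cs \<in> placements P qs"
    then have "length cs = length qs" by (simp add: placements_def)
    then have "map area (map2 translate cs qs) = map area qs"
      by (intro nth_equalityI) simp_all
    then show "g (sum_list (map area (map2 translate cs qs))) = g (sum_list (map area qs))" by simp
  qed
  finally show ?thesis by simp
qed

lemma hole_sets_hole_lists:
  assumes "H \<in> hole_sets C P r s"
  shows "{ys \<in> hole_lists C P r s. set ys = H} = permutations_of_set H"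
  using assms
  by (auto simp: hole_sets_def hole_lists_def permutations_of_set_def sum_list_distinct_conv_sum_set distinct_card)

lemma hole_lists_hole_sets: "ys \<in> hole_lists C P r s \<Longrightarrow> set ys \<in> hole_sets C P r s"
  by (auto simp: hole_sets_def hole_lists_def sum_list_distinct_conv_sum_set distinct_card)

lemma finite_hole_sets:
  assumes "polygon_class C" "self_avoiding_polygon P"
  shows "finite (hole_sets C P r s)"
proof -
  have "hole_sets C P r s \<subseteq> set ` hole_lists C P r s"
  proof
    fix H assume H: "H \<in> hole_sets C P r s"
    then have "finite H" by (simp add: hole_sets_def)
    then obtain ys where "ys \<in> permutations_of_set H"
      using finite_distinct_list by (metis permutations_of_setI)
    then show "H \<in> set ` hole_lists C P r s" using hole_sets_hole_lists[OF H] by blast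
  qed
  then show ?thesis by (rule finite_surj[OF finite_hole_lists[OF assms]])
qed

text \<open>A set of \<open>r\<close> holes has exactly \<open>fact r\<close> orderings, all of
  which lie in \<open>hole_lists\<close> and carry the same total area.\<close>

lemma sum_hole_sets:
  fixes g :: "nat \<Rightarrow> real"
  assumes C: "polygon_class C" and P: "self_avoiding_polygon P"
  shows "fact r * (\<Sum>H\<in>hole_sets C P r s. g (\<Sum>Q\<in>H. area Q)) =
    (\<Sum>ys\<in>hole_lists C P r s. g (sum_list (map area ys)))"
proof -
  have "(\<Sum>ys\<in>hole_lists C P r s. g (sum_list (map area ys))) = (\<Sum>ys\<in>hole_lists C P r s. g (\<Sum>Q\<in>set ys. area Q))"
    by (intro sum.cong) (simp_all add: hole_lists_def sum_list_distinct_conv_sum_set)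
  also have "\<dots> = (\<Sum>H\<in>hole_sets C P r s. \<Sum>ys\<in>{ys \<in> hole_lists C P r s. set ys = H}. g (\<Sum>Q\<in>set ys. area Q))"
    using hole_lists_hole_sets
    by (intro sum.group[symmetric] finite_hole_lists finite_hole_sets assms) blast
  also have "\<dots> = (\<Sum>H\<in>hole_sets C P r s. fact r * g (\<Sum>Q\<in>H. area Q))"
  proof (intro sum.cong refl)
    fix H assume H: "H \<in> hole_sets C P r s"
    then have "card {ys \<in> hole_lists C P r s. set ys = H} = fact r"
      unfolding hole_sets_hole_lists[OF H] by (simp add: hole_sets_def)
    then show "(\<Sum>ys\<in>{ys \<in> hole_lists C P r s. set ys = H}. g (\<Sum>Q\<in>set ys. area Q)) = fact r * g (\<Sum>Q\<in>H. area Q)"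
      by simp
  qed
  finally show ?thesis by (simp add: sum_distrib_left)
qed

section \<open>Moments of punctured polygons\<close>

text \<open>A set never meets its own inside, so for holes inside \<open>P\<close> disjointness over
  \<open>insert P H\<close> amounts to disjointness over \<open>H\<close>.\<close>

lemma punctured_polygons_iff:
  "(P, H) \<in> punctured_polygons C r \<and> holes_half_perimeter (P, H) = s \<longleftrightarrow> P \<in> C \<and> H \<in> hole_sets C P r s"
proof -
  have "pairwise (\<lambda>Q R. disjnt (boundary Q) (boundary R)) (insert P H) \<longleftrightarrow>
    pairwise (\<lambda>Q R. disjnt (boundary Q) (boundary R)) H"
    if "\<forall>Q\<in>H. boundary Q \<subseteq> inside (boundary P)"
  proof -
    have "boundary P \<inter> boundary Q = {}" if "Q \<in> H" for Q
      using that \<open>\<forall>Q\<in>H. _\<close> inside_no_overlap[of "boundary P"] by blast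
    then show ?thesis
      unfolding pairwise_insert disjnt_def by blast
  qed
  then have "(\<forall>Q\<in>H. boundary Q \<subseteq> inside (boundary P)) \<and>
      pairwise (\<lambda>Q R. disjnt (boundary Q) (boundary R)) (insert P H) \<longleftrightarrow>
    (\<forall>Q\<in>H. boundary Q \<subseteq> inside (boundary P)) \<and>
      pairwise (\<lambda>Q R. disjnt (boundary Q) (boundary R)) H"
    by argo
  then show ?thesis
    unfolding punctured_polygons_def hole_sets_def holes_half_perimeter_def mem_Collect_eq prod.case snd_conv
    by argo
qed

lemma hole_sets_translate:
  assumes C: "polygon_class C" and H: "H \<in> hole_sets C P r s"
  shows "translate t ` H \<in> hole_sets C (translate t P) r s"
    and "(\<Sum>Q\<in>translate t ` H. int (area Q)) = (\<Sum>Q\<in>H. int (area Q))"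
proof -
  have inj: "inj_on (translate t) H"
    using inj_translate by (rule inj_on_subset) simp
  show "(\<Sum>Q\<in>translate t ` H. int (area Q)) = (\<Sum>Q\<in>H. int (area Q))"
    by (simp add: sum.reindex[OF inj])
  have disj: "disjnt (boundary (translate t Q)) (boundary (translate t R))"
    if "disjnt (boundary Q) (boundary R)" for Q R
    using that unfolding boundary_translate disjnt_def by (auto simp flip: image_Int)
  have "(\<Sum>Q\<in>translate t ` H. half_perimeter Q) = (\<Sum>Q\<in>H. half_perimeter Q)"
    by (simp add: sum.reindex[OF inj])
  moreover have "card (translate t ` H) = card H" using inj by (rule card_image)
  moreover have "boundary (translate t Q) \<subseteq> inside (boundary (translate t P))"
    if "boundary Q \<subseteq> inside (boundary P)" for Q
    unfolding boundary_translate inside_translate using that by (rule image_mono)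
  moreover have "pairwise (\<lambda>Q R. disjnt (boundary Q) (boundary R)) (translate t ` H)"
  proof (rule pairwiseI)
    fix y z assume "y \<in> translate t ` H" "z \<in> translate t ` H" "y \<noteq> z"
    then obtain Q R where "Q \<in> H" "R \<in> H" "Q \<noteq> R" "y = translate t Q" "z = translate t R" by blast
    then show "disjnt (boundary y) (boundary z)"
      using H disj by (simp add: hole_sets_def pairwise_def)
  qed
  moreover have "translate t ` H \<subseteq> C"
    using H class_translate[OF C] unfolding hole_sets_def by blast
  ultimately show "translate t ` H \<in> hole_sets C (translate t P) r s"
    using H unfolding hole_sets_def by simp
qed

text \<open>Only the outer polygon is normalised: two normalised outer polygons related by a
  translation coincide, the vector is then zero, and so the holes agree too. With
  \<open>m + s\<close> in total, \<open>m\<close> is left for the outer polygon.\<close>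

lemma punctured_count_eq:
  assumes C: "polygon_class C"
  shows "punctured_count C r s (m + s) n =
    card {X \<in> SIGMA P:{P \<in> representatives C. half_perimeter P = m}. hole_sets C P r s.
      punctured_area X = int n}"
  unfolding punctured_count_def
proof (rule card_quotient_transversal[OF equiv_punctured_transl])
  let ?X = "{X \<in> punctured_polygons C r. punctured_half_perimeter X = m + s \<and>
    punctured_area X = int n \<and> holes_half_perimeter X = s}"
  let ?S = "{X \<in> SIGMA P:{P \<in> representatives C. half_perimeter P = m}. hole_sets C P r s.
      punctured_area X = int n}"
  have X: "(P, H) \<in> ?X \<longleftrightarrow> P \<in> C \<and> half_perimeter P = m \<and> H \<in> hole_sets C P r s \<and> punctured_area (P, H) = int n" for P H
    using punctured_polygons_iff[of P H C r s] by (auto simp: punctured_half_perimeter_def)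
  have S: "(P, H) \<in> ?S \<longleftrightarrow> P \<in> representatives C \<and> half_perimeter P = m \<and> H \<in> hole_sets C P r s \<and> punctured_area (P, H) = int n" for P H
    by simp
  show "?S \<subseteq> ?X"
  proof
    fix Y assume "Y \<in> ?S"
    then obtain P H where Y: "Y = (P, H)" "(P, H) \<in> ?S" by (cases Y) simp
    from Y(2) show "Y \<in> ?X"
      unfolding Y(1) X S using representativesD(1)[OF C] by blast
  qed
  show "\<exists>Z\<in>?S. (Y, Z) \<in> punctured_transl" if YX: "Y \<in> ?X" for Y
  proof -
    obtain P H where Y: "Y = (P, H)" by (cases Y)
    from YX have P: "P \<in> C" "half_perimeter P = m" and H: "H \<in> hole_sets C P r s"
      and area: "punctured_area (P, H) = int n"
      unfolding Y X by blast+
    obtain t Q where Q: "Q \<in> representatives C" "P = translate t Q"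
      using ex_representative[OF C P(1)] by blast
    let ?H = "translate (- t) ` H"
    have "?H \<in> hole_sets C Q r s"
      using hole_sets_translate(1)[OF C H, of "- t"] by (simp add: Q(2))
    moreover have "punctured_area (Q, ?H) = int n"
      using hole_sets_translate(2)[OF C H, of "- t"] area by (simp add: punctured_area_def Q(2))
    ultimately have "(Q, ?H) \<in> ?S"
      unfolding S using Q P(2) by simp
    moreover have "(Y, (Q, ?H)) \<in> punctured_transl"
      unfolding Y punctured_transl_iff by (rule exI[of _ "- t"]) (simp add: Q(2))
    ultimately show ?thesis by blast
  qed
  show "Y = Z" if YZ: "Y \<in> ?S" "Z \<in> ?S" "(Y, Z) \<in> punctured_transl" for Y Z
  proof -
    obtain P H where Y: "Y = (P, H)" by (cases Y)
    obtain Q K where Z: "Z = (Q, K)" by (cases Z)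
    have rep: "P \<in> representatives C" "Q \<in> representatives C"
      using YZ(1,2) unfolding Y Z S by blast+
    obtain t where t: "Q = translate t P" "K = translate t ` H"
      using YZ(3) unfolding Y Z punctured_transl_iff by blast
    have "translate 0 Q = translate t P" using t(1) by simp
    from representatives_unique[OF C rep(2,1) this] have "Q = P" "t = 0" by simp_all
    then show ?thesis unfolding Y Z t(2) by simp
  qed
qed

text \<open>The case distinction discards configurations of negative area, which nested holes could
  produce and which the count by \<open>punctured_area X = int n\<close> never sees.\<close>

definition punctured_weight :: "nat \<Rightarrow> nat \<Rightarrow> nat \<Rightarrow> real" where
  "punctured_weight k n a = (if a \<le> n then real (n - a) ^ k else 0)"

lemma punctured_moment_eq:
  assumes C: "polygon_class C"
  shows "punctured_moment C r k s (m + s) =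
    (\<Sum>P | P \<in> representatives C \<and> half_perimeter P = m.
      \<Sum>H\<in>hole_sets C P r s. punctured_weight k (area P) (\<Sum>Q\<in>H. area Q))"
proof -
  let ?R = "{P \<in> representatives C. half_perimeter P = m}"
  let ?S = "SIGMA P:?R. hole_sets C P r s"
  have finR: "finite ?R" by (rule finite_representatives_eq[OF C])
  have finH: "\<forall>P\<in>?R. finite (hole_sets C P r s)"
    using finite_hole_sets[OF C] representativesD(2)[OF C] by blast
  have "punctured_moment C r k s (m + s) = (\<Sum>n. real n ^ k * real (card {X \<in> ?S. punctured_area X = int n}))"
    unfolding punctured_moment_def punctured_count_eq[OF C] ..
  also have "\<dots> = (\<Sum>X | X \<in> ?S \<and> punctured_area X \<ge> 0. real (nat (punctured_area X)) ^ k)"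
    using finR finH by (intro suminf_card_eq_sum finite_SigmaI) blast+
  also have "\<dots> = (\<Sum>X\<in>?S. if punctured_area X \<ge> 0 then real (nat (punctured_area X)) ^ k else 0)"
    using finR finH by (intro sum.inter_filter finite_SigmaI) blast+
  also have "\<dots> = (\<Sum>(P, H)\<in>?S. punctured_weight k (area P) (\<Sum>Q\<in>H. area Q))"
  proof (intro sum.cong refl)
    fix X :: punctured
    obtain P H where X: "X = (P, H)" by (cases X)
    define a where "a = (\<Sum>Q\<in>H. area Q)"
    have pa: "punctured_area X = int (area P) - int a"
      unfolding X punctured_area_def a_def by simp
    show "(if punctured_area X \<ge> 0 then real (nat (punctured_area X)) ^ k else 0) =
      (case X of (P, H) \<Rightarrow> punctured_weight k (area P) (\<Sum>Q\<in>H. area Q))"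
      unfolding pa unfolding X prod.case punctured_weight_def a_def[symmetric]
      by (cases "a \<le> area P") (simp_all add: nat_diff_distrib)
  qed
  also have "\<dots> = (\<Sum>P\<in>?R. \<Sum>H\<in>hole_sets C P r s. punctured_weight k (area P) (\<Sum>Q\<in>H. area Q))"
    using finR finH by (rule sum.Sigma[symmetric])
  finally show ?thesis .
qed

section \<open>Comparing configurations with a power of the outer area\<close>

lemma punctured_weight_nonneg: "0 \<le> punctured_weight k n a"
  by (simp add: punctured_weight_def)

lemma punctured_weight_le: "punctured_weight k n a \<le> real n ^ k"
  by (simp add: punctured_weight_def power_mono)

text \<open>This is the first order bound on the loss \<open>n ^ k - (n - a) ^ k\<close>, multiplied
  by \<open>n\<close> to avoid the exponent \<open>k - 1\<close>. The extra 1 in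
  \<open>real k + 1\<close> covers \<open>n < a\<close>, where the weight is 0 and the loss is all
  of \<open>n ^ k\<close>.\<close>

lemma punctured_weight_ge:
  "real n * (real n ^ k - punctured_weight k n a) \<le> real a * (real k + 1) * real n ^ k"
proof (cases "a \<le> n")
  case True
  define x where "x = real n - real a"
  have x: "0 \<le> x" "x \<le> real n" using True by (simp_all add: x_def)
  have "real n * (real n ^ k - x ^ k) \<le> real a * real k * real n ^ k" for k
  proof (induction k)
    case (Suc k)
    \<comment> \<open>With \<open>a = n - x\<close>, this splits the loss for exponent
      \<open>Suc k\<close> into \<open>n\<close> times the loss for \<open>k\<close> and
      \<open>a * x ^ k\<close>.\<close>
    have "real n * (real n ^ Suc k - x ^ Suc k) =
      real n * (real n * (real n ^ k - x ^ k)) + real a * (real n * x ^ k)"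
      by (simp add: x_def algebra_simps)
    also have "\<dots> \<le> real n * (real a * real k * real n ^ k) + real a * (real n * real n ^ k)"
      using Suc.IH x by (intro add_mono mult_left_mono power_mono) simp_all
    also have "\<dots> = real a * real (Suc k) * real n ^ Suc k"
      by (simp add: algebra_simps)
    finally show ?case .
  qed simp
  from this[of k] have "real n * (real n ^ k - x ^ k) \<le> real a * real k * real n ^ k" .
  also have "\<dots> \<le> real a * (real k + 1) * real n ^ k"
    by (intro mult_right_mono mult_left_mono) simp_all
  finally show ?thesis
    using True by (simp add: punctured_weight_def x_def of_nat_diff)
next
  case False
  then have "real n * real n ^ k \<le> real a * real n ^ k"
    by (intro mult_right_mono) simp_all
  also have "\<dots> \<le> real a * (real k + 1) * real n ^ k"
    by (intro mult_right_mono) (simp_all add: algebra_simps)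
  finally show ?thesis
    using False by (simp add: punctured_weight_def)
qed

text \<open>The placements fall short of \<open>n ^ r\<close> by the excluded positions, and the
  weight falls short of \<open>n ^ k\<close> by the removed hole area. \<open>K\<close> collects one
  term for each defect and does not depend on \<open>P\<close>.\<close>

lemma placements_weight_bounds:
  fixes k :: nat
  assumes C: "polygon_class C" and P: "self_avoiding_polygon P" and qs: "qs \<in> hole_types C r s"
    and "r \<ge> 1" and a: "a \<le> b"
  defines "K \<equiv> real (r * (6 + r) * (32 * s + 21) ^ 2) + real b * (real k + 1)"
  shows "\<bar>real (card (placements P qs)) * punctured_weight k (area P) a - real (area P) ^ (k + r)\<bar>
    \<le> K * (real (half_perimeter P) + 1) * real (area P) ^ (k + r - 1)"
proof -
  define n g w m where "n = real (area P)" and "g = real (card (placements P qs))"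
    and "w = punctured_weight k (area P) a" and "m = real (half_perimeter P)"
  have r: "length qs = r" using qs by (simp add: hole_types_def)
  have pos: "0 \<le> n" "0 \<le> g" "0 \<le> m" by (simp_all add: n_def g_def m_def)
  have g: "g \<le> n ^ r"
    using finite_placements(2)[OF P, of qs] unfolding r n_def g_def by (metis of_nat_mono of_nat_power)
  have w: "0 \<le> w" "w \<le> n ^ k"
    unfolding w_def n_def by (rule punctured_weight_nonneg punctured_weight_le)+
  have pow: "n ^ (k + r) = n ^ k * n ^ r" "n ^ r = n * n ^ (r - 1)" "n ^ (k + r - 1) = n ^ k * n ^ (r - 1)"
    using \<open>r \<ge> 1\<close> by (cases r; simp add: power_add)+
  have "n ^ r - g \<le> real (r * (area P ^ (r - 1) * ((4 * half_perimeter P + 2 + r) * (32 * s + 21) ^ 2)))"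
    using card_placements_ge[OF C P qs] unfolding n_def g_def
    by (metis (no_types, lifting) diff_le_eq add.commute of_nat_add of_nat_mono of_nat_power)
  also have "\<dots> = real r * (n ^ (r - 1) * ((4 * m + 2 + real r) * real ((32 * s + 21) ^ 2)))"
    unfolding n_def m_def by (simp add: algebra_simps)
  \<comment> \<open>Here \<open>4 * m + 2 + r\<close> is at most
    \<open>(6 + r) * (m + 1)\<close>.\<close>
  also have "\<dots> \<le> real r * (n ^ (r - 1) * (((6 + real r) * (m + 1)) * real ((32 * s + 21) ^ 2)))"
    using pos by (intro mult_left_mono mult_right_mono) (simp_all add: algebra_simps)
  also have "\<dots> = real (r * (6 + r) * (32 * s + 21) ^ 2) * (m + 1) * n ^ (r - 1)"
    by simp
  finally have *: "n ^ r - g \<le> real (r * (6 + r) * (32 * s + 21) ^ 2) * (m + 1) * n ^ (r - 1)" .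
  have "n ^ (k + r) - g * w = (n ^ r - g) * n ^ k + g * (n ^ k - w)"
    by (simp add: pow algebra_simps)
  also have "\<dots> \<le> (n ^ r - g) * n ^ k + n ^ r * (n ^ k - w)"
    using g w by (intro add_left_mono mult_right_mono) simp_all
  \<comment> \<open>One factor \<open>n\<close> is taken out of \<open>n ^ r\<close>, which
    \<open>r \<ge> 1\<close> permits, to match the form of
    \<open>punctured_weight_ge\<close>.\<close>
  also have "\<dots> = (n ^ r - g) * n ^ k + n ^ (r - 1) * (n * (n ^ k - w))"
    by (simp add: pow(2))
  also have "\<dots> \<le> (real (r * (6 + r) * (32 * s + 21) ^ 2) * (m + 1) * n ^ (r - 1)) * n ^ k
      + n ^ (r - 1) * (real a * (real k + 1) * n ^ k)"
    using * pos punctured_weight_ge[of "area P" k a] unfolding w_def n_def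
    by (intro add_mono mult_left_mono mult_right_mono) simp_all
  also have "\<dots> = (real (r * (6 + r) * (32 * s + 21) ^ 2) * (m + 1) + real a * (real k + 1)) * n ^ (k + r - 1)"
    unfolding pow(3) by (simp add: algebra_simps)
  also have "\<dots> \<le> (K * (m + 1)) * n ^ (k + r - 1)"
  proof (rule mult_right_mono)
    have "real a * (real k + 1) \<le> real b * (real k + 1) * (m + 1)"
      using a pos mult_mono[of "real a * (real k + 1)" "real b * (real k + 1)" 1 "m + 1"]
      by (simp add: mult_right_mono)
    then show "real (r * (6 + r) * (32 * s + 21) ^ 2) * (m + 1) + real a * (real k + 1) \<le> K * (m + 1)"
      unfolding K_def by (simp add: algebra_simps)
  qed (use pos in simp)
  finally have "n ^ (k + r) - g * w \<le> K * (m + 1) * n ^ (k + r - 1)" .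
  moreover have "g * w \<le> n ^ (k + r)"
    unfolding pow(1) using mult_mono[OF g w(2)] w pos by (simp add: mult.commute)
  ultimately show ?thesis
    unfolding n_def[symmetric] g_def[symmetric] w_def[symmetric] m_def[symmetric] by linarith
qed

text \<open>The bound for a single outer polygon is summed over all representatives of
  half-perimeter \<open>m\<close>. Only finitely many shape lists have total half-perimeter
  \<open>s\<close>, so one constant serves them all.\<close>

lemma punctured_moment_estimate:
  assumes C: "polygon_class C" and r: "r \<ge> 1"
  shows "\<exists>K. \<forall>m. \<bar>punctured_moment C r k s (m + s) -
      fps_nth (poly_gf C ^ r) s / fact r * poly_moment C (k + r) m\<bar>
    \<le> K * (real m + 1) * poly_moment C (k + r - 1) m"
proof -
  let ?T = "hole_types C r s" and ?c = "fps_nth (poly_gf C ^ r) s"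
  \<comment> \<open>A sum of nonnegative terms dominates each of them, so \<open>b\<close> bounds
    the total hole area for every shape list.\<close>
  define b where "b = (\<Sum>qs\<in>?T. sum_list (map area qs))"
  define K where "K = real (r * (6 + r) * (32 * s + 21) ^ 2) + real b * (real k + 1)"
  have c: "?c = real (card ?T)" by (rule fps_nth_poly_gf_power[OF C])
  have area_le: "sum_list (map area qs) \<le> b" if "qs \<in> ?T" for qs
    unfolding b_def using that finite_hole_types[OF C] by (intro member_le_sum) simp_all
  \<comment> \<open>For one outer polygon, multiplying by \<open>fact r\<close> passes to ordered
    holes, where \<open>placements_weight_bounds\<close> applies to each shape list.\<close>
  have one: "\<bar>(\<Sum>H\<in>hole_sets C P r s. punctured_weight k (area P) (\<Sum>Q\<in>H. area Q)) - ?c / fact r * real (area P) ^ (k + r)\<bar>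
      \<le> ?c / fact r * K * (real (half_perimeter P) + 1) * real (area P) ^ (k + r - 1)"
    (is "\<bar>?W - _\<bar> \<le> _") if P: "self_avoiding_polygon P" for P
  proof -
    let ?E = "K * (real (half_perimeter P) + 1) * real (area P) ^ (k + r - 1)"
    have "fact r * ?W - ?c * real (area P) ^ (k + r) =
      (\<Sum>qs\<in>?T. real (card (placements P qs)) * punctured_weight k (area P) (sum_list (map area qs)) - real (area P) ^ (k + r))"
      using sum_hole_sets[OF C P, of r "punctured_weight k (area P)" s] sum_hole_lists[OF C P, of "punctured_weight k (area P)" r s]
      by (simp add: sum_subtractf c)
    also have "\<bar>\<dots>\<bar> \<le> (\<Sum>qs\<in>?T. ?E)"
    proof (rule order_trans[OF sum_abs sum_mono])
      fix qs assume qs: "qs \<in> ?T"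
      show "\<bar>real (card (placements P qs)) * punctured_weight k (area P) (sum_list (map area qs)) - real (area P) ^ (k + r)\<bar> \<le> ?E"
        unfolding K_def by (rule placements_weight_bounds[OF C P qs r area_le[OF qs]])
    qed
    also have "\<dots> = ?c * ?E" by (simp add: c)
    finally have "\<bar>fact r * ?W - ?c * real (area P) ^ (k + r)\<bar> / fact r \<le> ?c * ?E / fact r"
      by (intro divide_right_mono) simp_all
    moreover have "\<bar>fact r * ?W - ?c * real (area P) ^ (k + r)\<bar> / fact r = \<bar>?W - ?c / fact r * real (area P) ^ (k + r)\<bar>"
    proof -
      have "?W - ?c / fact r * real (area P) ^ (k + r) = (fact r * ?W - ?c * real (area P) ^ (k + r)) / fact r"
        by (simp add: field_simps)
      then show ?thesis by simp
    qed
    ultimately show ?thesis by (simp add: mult.assoc)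
  qed
  have "\<bar>punctured_moment C r k s (m + s) - ?c / fact r * poly_moment C (k + r) m\<bar>
    \<le> ?c / fact r * K * (real m + 1) * poly_moment C (k + r - 1) m" for m
  proof -
    let ?R = "{P \<in> representatives C. half_perimeter P = m}"
    have eq: "punctured_moment C r k s (m + s) - ?c / fact r * poly_moment C (k + r) m =
      (\<Sum>P\<in>?R. (\<Sum>H\<in>hole_sets C P r s. punctured_weight k (area P) (\<Sum>Q\<in>H. area Q)) - ?c / fact r * real (area P) ^ (k + r))"
      (is "_ = (\<Sum>P\<in>?R. ?d P)")
      unfolding punctured_moment_eq[OF C] poly_moment_eq[OF C] sum_subtractf sum_distrib_left ..
    have "\<bar>\<Sum>P\<in>?R. ?d P\<bar> \<le> (\<Sum>P\<in>?R. \<bar>?d P\<bar>)"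
      by (rule sum_abs)
    also have "\<dots> \<le> (\<Sum>P\<in>?R. ?c / fact r * K * (real m + 1) * real (area P) ^ (k + r - 1))"
    proof (rule sum_mono)
      fix P assume "P \<in> ?R"
      then have "self_avoiding_polygon P" "half_perimeter P = m"
        by (simp_all add: representativesD(2)[OF C])
      from one[OF this(1), unfolded this(2)]
      show "\<bar>?d P\<bar> \<le> ?c / fact r * K * (real m + 1) * real (area P) ^ (k + r - 1)" .
    qed
    also have "\<dots> = ?c / fact r * K * (real m + 1) * poly_moment C (k + r - 1) m"
      unfolding poly_moment_eq[OF C] sum_distrib_left ..
    finally show ?thesis unfolding eq .
  qed
  then show ?thesis by blast
qed

section \<open>Asymptotics\<close>

lemma asymp_equiv_sequentially_offset:
  fixes f g :: "nat \<Rightarrow> real"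
  assumes "(\<lambda>n. f (n + s)) \<sim>[at_top] (\<lambda>n. g (n + s))"
  shows "f \<sim>[at_top] g"
  \<comment> \<open>The sequence is the quotient by which \<open>asymp_equiv\<close> is defined,
    with value 1 where both functions vanish.\<close>
  using assms LIMSEQ_offset[of "\<lambda>n. if f n = 0 \<and> g n = 0 then 1 else f n / g n" s 1]
  unfolding asymp_equiv_def by blast


theorem theorem1:
  fixes C :: "polygon set" and A \<gamma> :: "nat \<Rightarrow> real" and x\<^sub>c \<theta> \<phi> :: real and r s :: nat
  assumes "polygon_class C"
    and "\<And>k. A k > 0" and "x\<^sub>c > 0"
    and "0 < \<phi>" and "\<phi> < 1"
    and "\<And>k. \<gamma> k = (real k - \<theta>) / \<phi>"
    and "\<And>k. poly_moment C k \<sim>[at_top]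
               (\<lambda>m. A k * x\<^sub>c powi (- int m) * real m powr (\<gamma> k - 1))"
    and "r \<ge> 1"
    and "fps_nth (poly_gf C ^ r) s \<noteq> 0"
  shows "\<forall>k. punctured_moment C r k s \<sim>[at_top]
               (\<lambda>m. (A (k + r) / fact r * x\<^sub>c ^ s * fps_nth (poly_gf C ^ r) s)
                     * x\<^sub>c powi (- int m) * real m powr (\<gamma> (k + r) - 1))"
proof
  fix k
  let ?M = "poly_moment C"
  define c where "c = fps_nth (poly_gf C ^ r) s / fact r"
  define F where "F j m = A j * x\<^sub>c powi (- int m) * real m powr (\<gamma> j - 1)" for j m
  have c: "c \<noteq> 0" using assms(9) by (simp add: c_def)
  have M: "?M j \<sim>[at_top] F j" for j
    using assms(7)[of j] unfolding F_def .
  obtain K where K: "\<And>m. \<bar>punctured_moment C r k s (m + s) - c * ?M (k + r) m\<bar>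
      \<le> K * (real m + 1) * ?M (k + r - 1) m"
    using punctured_moment_estimate[OF assms(1,8), of k s] unfolding c_def by blast
  \<comment> \<open>Lowering the order of the moment by one lowers the exponent of \<open>m\<close>
    by \<open>1 / \<phi>\<close>.\<close>
  have gap: "\<gamma> (k + r - 1) = \<gamma> (k + r) - 1 / \<phi>"
    using \<open>r \<ge> 1\<close> unfolding assms(6) by (simp add: of_nat_diff diff_divide_distrib)
  have "1 / \<phi> > 1" using assms(4,5) by simp
  \<comment> \<open>The factor \<open>m + 1\<close> costs one power of \<open>m\<close>, while the
    lower moment saves \<open>1 / \<phi> > 1\<close> powers. This is where \<open>\<phi> < 1\<close>
    enters.\<close>
  have lower: "(\<lambda>m. (real m + 1) * F (k + r - 1) m) \<in> o(F (k + r))"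
  proof (rule smalloI_tendsto)
    have "(\<lambda>m. A (k + r - 1) / A (k + r) * ((real m + 1) * real m powr (- (1 / \<phi>)))) \<longlonglongrightarrow> A (k + r - 1) / A (k + r) * 0"
      using \<open>1 / \<phi> > 1\<close> by (intro tendsto_mult tendsto_const) real_asymp
    moreover have "(real m + 1) * F (k + r - 1) m / F (k + r) m =
        A (k + r - 1) / A (k + r) * ((real m + 1) * real m powr (- (1 / \<phi>)))" if "m > 0" for m
    proof -
      have "real m powr (\<gamma> (k + r - 1) - 1) = real m powr (\<gamma> (k + r) - 1) * real m powr (- (1 / \<phi>))"
        unfolding gap by (simp add: algebra_simps flip: powr_add)
      then show ?thesis
        unfolding F_def using assms(2)[of "k + r"] assms(3) that by simp
    qed
    then have "\<forall>\<^sub>F m in sequentially. A (k + r - 1) / A (k + r) * ((real m + 1) * real m powr (- (1 / \<phi>))) =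
        (real m + 1) * F (k + r - 1) m / F (k + r) m"
      by (intro eventually_mono[OF eventually_gt_at_top[of "0::nat"]]) simp
    ultimately show "(\<lambda>m. (real m + 1) * F (k + r - 1) m / F (k + r) m) \<longlonglongrightarrow> 0"
      using Lim_transform_eventually by fastforce
    show "\<forall>\<^sub>F m in sequentially. F (k + r) m \<noteq> 0"
      using assms(2)[of "k + r"] assms(3) unfolding F_def
      by (intro eventually_mono[OF eventually_gt_at_top[of "0::nat"]]) simp
  qed
  \<comment> \<open>The error is carried from the moments to their asymptotic forms, where
    \<open>lower\<close> applies, and back to \<open>c * ?M (k + r) m\<close>, of which it is thus a
    little-o.\<close>
  have "(\<lambda>m. punctured_moment C r k s (m + s) - c * ?M (k + r) m) \<in> O(\<lambda>m. (real m + 1) * ?M (k + r - 1) m)"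
  proof (intro bigoI[of _ "\<bar>K\<bar>"] always_eventually allI)
    fix m
    have "\<bar>punctured_moment C r k s (m + s) - c * ?M (k + r) m\<bar> \<le> \<bar>K * ((real m + 1) * ?M (k + r - 1) m)\<bar>"
      using order_trans[OF K[of m] abs_ge_self] by (simp only: mult.assoc)
    then show "norm (punctured_moment C r k s (m + s) - c * ?M (k + r) m)
        \<le> \<bar>K\<bar> * norm ((real m + 1) * ?M (k + r - 1) m)"
      by (simp only: abs_mult real_norm_def)
  qed
  also have "(\<lambda>m. (real m + 1) * ?M (k + r - 1) m) \<in> O(\<lambda>m. (real m + 1) * F (k + r - 1) m)"
    by (intro landau_o.big.mult landau_o.big_refl asymp_equiv_imp_bigo M)
  also note lower
  also have "F (k + r) \<in> \<Theta>(\<lambda>m. c * ?M (k + r) m)"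
    using c asymp_equiv_imp_bigtheta[OF M[of "k + r"]] by (simp add: bigtheta_sym)
  finally have "(\<lambda>m. punctured_moment C r k s (m + s)) \<sim>[at_top] (\<lambda>m. c * ?M (k + r) m)"
    by (rule smallo_imp_asymp_equiv)
  also have "\<dots> \<sim>[at_top] (\<lambda>m. c * F (k + r) m)"
    by (intro asymp_equiv_intros M)
  \<comment> \<open>Everything is rewritten in terms of \<open>m + s\<close>: the shift leaves the
    power of \<open>m\<close> asymptotically unchanged but produces the factor
    \<open>x\<^sub>c ^ s\<close>.\<close>
  also have "\<dots> \<sim>[at_top] (\<lambda>m. (A (k + r) / fact r * x\<^sub>c ^ s * fps_nth (poly_gf C ^ r) s)
      * x\<^sub>c powi (- int (m + s)) * real (m + s) powr (\<gamma> (k + r) - 1))"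
  proof -
    have "(\<lambda>m. real m powr (\<gamma> (k + r) - 1)) \<sim>[at_top] (\<lambda>m. real (m + s) powr (\<gamma> (k + r) - 1))"
      by real_asymp
    then have "(\<lambda>m. (c * A (k + r) * x\<^sub>c powi (- int m)) * real m powr (\<gamma> (k + r) - 1)) \<sim>[at_top]
      (\<lambda>m. (c * A (k + r) * x\<^sub>c powi (- int m)) * real (m + s) powr (\<gamma> (k + r) - 1))"
      by (rule asymp_equiv_mult[OF asymp_equiv_refl])
    moreover have "x\<^sub>c powi (- int m) = x\<^sub>c ^ s * x\<^sub>c powi (- int (m + s))" for m
      using assms(3) power_int_add[of x\<^sub>c "int s" "- int (m + s)"] by simp
    ultimately show ?thesis
      unfolding F_def c_def by (simp add: mult.assoc mult.left_commute)
  qed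
  finally show "punctured_moment C r k s \<sim>[at_top]
               (\<lambda>m. (A (k + r) / fact r * x\<^sub>c ^ s * fps_nth (poly_gf C ^ r) s)
                     * x\<^sub>c powi (- int m) * real m powr (\<gamma> (k + r) - 1))"
    by (rule asymp_equiv_sequentially_offset)
qed

end
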